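(* Let $\epsilon\in\{1,-1\}$ and let $f:M^3\to\mathbb{Q}^4_\epsilon\times\mathbb{R}$ be a biconservative submanifold (isometric immersion) with nonzero parallel mean curvature vector field, locally given as $$f(p,s)=\left(b\cos\frac{s}{b},\ b\sin\frac{s}{b},\ \phi(p)\right),\qquad (p,s)\in M^2\times I,$$ where $a\neq0$ and $b>0$ are real numbers with $|a|<1$ and $a^2+b^2=1$, $\phi:M^2\to\mathbb{Q}^2_a\times\mathbb{R}$ is an oriented minimal surface whose associated tangent vector field $T_\phi$ is nowhere vanishing, and $I\subset\mathbb{R}$ is an open interval. Then $f$ is an immersion in class $\mathcal{A}$.
   Context: $\mathbb{Q}^n_\epsilon$ denotes the unit sphere $\mathbb{S}^n$ if $\epsilon=1$ and the hyperbolic space $\mathbb{H}^n$ if $\epsilon=-1$. $\mathbb{E}^{k}$ denotes $k$-dimensional Euclidean space if $\epsilon=1$ and $k$-dimensional Lorentzian space if $\epsilon=-1$; $\mathbb{Q}^n_\epsilon\subset\mathbb{E}^{n+1}$ is (one connected component if $\epsilon=-1$ of) $\{x:\langle x,x\rangle=\epsilon\}$, so $\mathbb{Q}^n_\epsilon\times\mathbb{R}\subset\mathbb{E}^{n+2}$. Write $\mathbb{E}^6=\mathbb{R}^2\times\mathbb{E}^3\times\mathbb{R}$ with $\mathbb{R}^2$ Euclidean; in the displayed formula the first two coordinates lie in $\mathbb{R}^2$ and $\phi(p)\in\mathbb{E}^3\times\mathbb{R}$. $\mathbb{Q}^2_a$ denotes the two-dimensional space form in $\mathbb{E}^3$ consisting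 of those $x$ for which $(b\cos\frac{s}{b},b\sin\frac{s}{b},x)\in\mathbb{Q}^4_\epsilon$ (for $\epsilon=1$, the sphere of radius $|a|$), so that $f$ takes values in $\mathbb{Q}^4_\epsilon\times\mathbb{R}$. For an isometric immersion $f$ of a Riemannian manifold $M$ into $\mathbb{Q}^n_\epsilon\times\mathbb{R}$ or into $\mathbb{Q}^2_a\times\mathbb{R}$, let $\partial_t$ be a unit vector field tangent to the factor $\mathbb{R}$; the tangent field $T$ on $M$ and the normal field $\eta$ along $f$ are defined by $\partial_t=f_*T+\eta$ (for $\phi$ the tangent field is denoted $T_\phi$). Class $\mathcal{A}$ is the class of isometric immersions $f:M^m\to\mathbb{Q}^n_\epsilon\times\mathbb{R}$ with the property that $T$ is an eigenvector of all shape operators of $f$. For an isometric immersion $f:M^m\to N$ with second fundamental form $\alpha$, $H=\frac1m\operatorname{trace}\alpha$ is the mean curvature vector field; it is parallel if $\nabla^\perp H=0$. The bitension field is $\tau_2(f)=\Delta\tau(f)-\operatorname{trace}\tilde R(df,\tau(f))df$ with $\tau(f)=mH$, where $\Delta=\operatorname{trace}\nabla^2$ is the rough Laplacian on sections of $f^*TN$ and $\tilde R$ is the curvature tensor of $N$. $f$ is biconservative if the tangential component $\tau_2(f)^T$ vanishes identically. *)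

theory Defs
  imports "HOL-Analysis.Analysis"
begin

section \<open>Smooth maps and smooth manifolds\<close>

abbreviation deriv_at :: "('a::real_normed_vector \<Rightarrow> 'b::real_normed_vector) \<Rightarrow> 'a \<Rightarrow> 'a \<Rightarrow> 'b" where
  "deriv_at F u \<equiv> frechet_derivative F (at u)"

text \<open>Only used for open \<open>U\<close>.\<close>

fun ck_on :: "nat \<Rightarrow> 'a::euclidean_space set \<Rightarrow> ('a \<Rightarrow> 'b::euclidean_space) \<Rightarrow> bool" where
  "ck_on 0 U F \<longleftrightarrow> continuous_on U F"
| "ck_on (Suc k) U F \<longleftrightarrow> (\<forall>u\<in>U. F differentiable (at u)) \<and> (\<forall>v. ck_on k U (\<lambda>u. deriv_at F u v))"

definition smooth_on :: "'a::euclidean_space set \<Rightarrow> ('a \<Rightarrow> 'b::euclidean_space) \<Rightarrow> bool" where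
  "smooth_on U F \<longleftrightarrow> (\<forall>k. ck_on k U F)"

text \<open>
  An atlas consists of local parametrizations \<open>(U, x)\<close>, i.e. of the inverses \<open>x : U \<rightarrow> x ` U\<close> of
  coordinate charts. The manifold \<open>M\<close> is a subset of a Hausdorff, second countable type and carries
  the subspace topology.
\<close>

type_synonym ('m, 'p) atlas = "('m set \<times> ('m \<Rightarrow> 'p)) set"

definition transition :: "'m set \<times> ('m \<Rightarrow> 'p) \<Rightarrow> 'n set \<times> ('n \<Rightarrow> 'q) \<Rightarrow> ('p \<Rightarrow> 'q) \<Rightarrow> 'm set \<times> ('m \<Rightarrow> 'n)" where
  "transition c d F = (case (c, d) of ((U, x), (V, y)) \<Rightarrow>
     (U \<inter> (F \<circ> x) -` (y ` V), inv_into V y \<circ> (F \<circ> x)))"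

definition smooth_manifold ::
  "'p::{t2_space, second_countable_topology} set \<Rightarrow> ('m::euclidean_space, 'p) atlas \<Rightarrow> bool" where
  "smooth_manifold M A \<longleftrightarrow>
     (\<forall>(U, x)\<in>A. open U \<and> openin (top_of_set M) (x ` U) \<and> (\<exists>y. homeomorphism U (x ` U) x y)) \<and>
     (\<Union>(U, x)\<in>A. x ` U) = M \<and>
     (\<forall>c\<in>A. \<forall>d\<in>A. case transition c d id of (W, \<theta>) \<Rightarrow> smooth_on W \<theta>)"

definition oriented_manifold ::
  "'p::{t2_space, second_countable_topology} set \<Rightarrow> (real^'m, 'p) atlas \<Rightarrow> bool" where
  "oriented_manifold M A \<longleftrightarrow> smooth_manifold M A \<and>
     (\<forall>c\<in>A. \<forall>d\<in>A. case transition c d id of (W, \<theta>) \<Rightarrow> \<forall>u\<in>W. det (matrix (deriv_at \<theta> u)) > 0)"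

definition smooth_map ::
  "'p::topological_space set \<Rightarrow> ('m::euclidean_space, 'p) atlas \<Rightarrow>
   'q::topological_space set \<Rightarrow> ('n::euclidean_space, 'q) atlas \<Rightarrow> ('p \<Rightarrow> 'q) \<Rightarrow> bool" where
  "smooth_map M A N B F \<longleftrightarrow> F ` M \<subseteq> N \<and> continuous_on M F \<and>
     (\<forall>c\<in>A. \<forall>d\<in>B. case transition c d F of (W, \<theta>) \<Rightarrow> smooth_on W \<theta>)"

definition diffeo ::
  "'p::topological_space set \<Rightarrow> ('m::euclidean_space, 'p) atlas \<Rightarrow>
   'q::topological_space set \<Rightarrow> ('n::euclidean_space, 'q) atlas \<Rightarrow> ('p \<Rightarrow> 'q) \<Rightarrow> bool" where
  "diffeo M A N B F \<longleftrightarrow>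
     bij_betw F M N \<and> smooth_map M A N B F \<and> smooth_map N B M A (inv_into M F)"

definition restrict_atlas :: "('m, 'p) atlas \<Rightarrow> 'p set \<Rightarrow> ('m, 'p) atlas" where
  "restrict_atlas A W = (\<lambda>(U, x). (U \<inter> x -` W, x)) ` A"

definition prod_interval_atlas :: "('m, 'p) atlas \<Rightarrow> real set \<Rightarrow> ('m \<times> real, 'p \<times> real) atlas" where
  "prod_interval_atlas A I = (\<lambda>(U, x). (U \<times> I, map_prod x id)) ` A"


section \<open>Submanifolds of pseudo-Euclidean spaces\<close>

text \<open>
  A target space is given as a submanifold \<open>N\<close> of a vector space with a nondegenerate symmetric
  bilinear form \<open>g\<close>, whose restriction to each tangent space of \<open>N\<close> is the metric of \<open>N\<close>.
\<close>

definition velocity_curve :: "'e::real_normed_vector set \<Rightarrow> 'e \<Rightarrow> 'e \<Rightarrow> (real \<Rightarrow> 'e) \<Rightarrow> bool" where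
  "velocity_curve N y v \<gamma> \<longleftrightarrow>
     \<gamma> 0 = y \<and> (\<forall>\<^sub>F t in nhds 0. \<gamma> t \<in> N) \<and> (\<gamma> has_vector_derivative v) (at 0)"

definition tangent_space :: "'e::real_normed_vector set \<Rightarrow> 'e \<Rightarrow> 'e set" where
  "tangent_space N y = {v. \<exists>\<gamma>. velocity_curve N y v \<gamma>}"

definition orth_proj :: "('e \<Rightarrow> 'e \<Rightarrow> real) \<Rightarrow> 'e::real_vector set \<Rightarrow> 'e \<Rightarrow> 'e" where
  "orth_proj g S v = (THE p. p \<in> S \<and> (\<forall>w\<in>S. g (v - p) w = 0))"

text \<open>Trace of a bilinear map with respect to a positive definite inner product \<open>h\<close>.\<close>

definition orthonormal_basis :: "('m \<Rightarrow> 'm \<Rightarrow> real) \<Rightarrow> 'm::euclidean_space set \<Rightarrow> bool" where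
  "orthonormal_basis h E \<longleftrightarrow> finite E \<and> span E = UNIV \<and> card E = DIM('m) \<and>
     (\<forall>e\<in>E. \<forall>e'\<in>E. h e e' = (if e = e' then 1 else 0))"

definition metric_trace ::
  "('m \<Rightarrow> 'm \<Rightarrow> real) \<Rightarrow> ('m::euclidean_space \<Rightarrow> 'm \<Rightarrow> 'e::real_vector) \<Rightarrow> 'e" where
  "metric_trace h \<beta> = (let E = (SOME E. orthonormal_basis h E) in \<Sum>e\<in>E. \<beta> e e)"

text \<open>
  The Levi-Civita connection of \<open>N\<close> is the tangential part of the flat derivative. The curvature
  tensor \<open>R(u,v)w = \<nabla>\<^sub>U\<nabla>\<^sub>VW - \<nabla>\<^sub>V\<nabla>\<^sub>UW - \<nabla>\<^bsub>[U,V]\<^esub>W\<close> at a point of \<open>N\<close> does not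
  depend on how the tangent vectors are extended to tangent fields; they are extended by projecting
  the constant fields \<open>u\<close>, \<open>v\<close>, \<open>w\<close> onto the tangent spaces of \<open>N\<close>.
\<close>

definition field_deriv :: "'e::real_normed_vector set \<Rightarrow> ('e \<Rightarrow> 'e) \<Rightarrow> 'e \<Rightarrow> 'e \<Rightarrow> 'e" where
  "field_deriv N W y v =
     (THE d. \<forall>\<gamma>. velocity_curve N y v \<gamma> \<longrightarrow> ((W \<circ> \<gamma>) has_vector_derivative d) (at 0))"

definition target_conn ::
  "('e \<Rightarrow> 'e \<Rightarrow> real) \<Rightarrow> 'e::real_normed_vector set \<Rightarrow> ('e \<Rightarrow> 'e) \<Rightarrow> 'e \<Rightarrow> 'e \<Rightarrow> 'e" where
  "target_conn g N W y v = orth_proj g (tangent_space N y) (field_deriv N W y v)"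

definition target_curvature ::
  "('e \<Rightarrow> 'e \<Rightarrow> real) \<Rightarrow> 'e::real_normed_vector set \<Rightarrow> 'e \<Rightarrow> 'e \<Rightarrow> 'e \<Rightarrow> 'e \<Rightarrow> 'e" where
  "target_curvature g N y u v w =
     (let ext = (\<lambda>a z. orth_proj g (tangent_space N z) a) in
        target_conn g N (\<lambda>z. target_conn g N (ext w) z (ext v z)) y u
      - target_conn g N (\<lambda>z. target_conn g N (ext w) z (ext u z)) y v
      - target_conn g N (ext w) y (field_deriv N (ext v) y u - field_deriv N (ext u) y v))"


section \<open>Immersions in a local parametrization\<close>

text \<open>
  Here \<open>F\<close> is a parametrized immersion into \<open>N\<close>, tangent vectors of the source at the parameter
  \<open>u\<close> are written in coordinates, i.e. as vectors of the parameter space, and the source carries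
  the metric induced by \<open>F\<close>, so that \<open>F\<close> is isometric.
\<close>

definition induced_metric ::
  "('e \<Rightarrow> 'e \<Rightarrow> real) \<Rightarrow> ('m::euclidean_space \<Rightarrow> 'e::euclidean_space) \<Rightarrow> 'm \<Rightarrow> 'm \<Rightarrow> 'm \<Rightarrow> real" where
  "induced_metric g F u v w = g (deriv_at F u v) (deriv_at F u w)"

definition normal_space ::
  "('e \<Rightarrow> 'e \<Rightarrow> real) \<Rightarrow> 'e set \<Rightarrow> ('m::euclidean_space \<Rightarrow> 'e::euclidean_space) \<Rightarrow> 'm \<Rightarrow> 'e set" where
  "normal_space g N F u = {\<xi> \<in> tangent_space N (F u). \<forall>v. g \<xi> (deriv_at F u v) = 0}"

text \<open>Connection induced on sections \<open>V\<close> of the pullback bundle \<open>F\<^sup>*TN\<close>.\<close>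

definition pullback_conn ::
  "('e \<Rightarrow> 'e \<Rightarrow> real) \<Rightarrow> 'e set \<Rightarrow> ('m::euclidean_space \<Rightarrow> 'e::euclidean_space) \<Rightarrow>
   ('m \<Rightarrow> 'e) \<Rightarrow> 'm \<Rightarrow> 'm \<Rightarrow> 'e" where
  "pullback_conn g N F V u v = orth_proj g (tangent_space N (F u)) (deriv_at V u v)"

text \<open>\<open>w\<close> is extended to the coordinate field that is constant in the parameter space.\<close>

definition second_ff ::
  "('e \<Rightarrow> 'e \<Rightarrow> real) \<Rightarrow> 'e set \<Rightarrow> ('m::euclidean_space \<Rightarrow> 'e::euclidean_space) \<Rightarrow>
   'm \<Rightarrow> 'm \<Rightarrow> 'm \<Rightarrow> 'e" where
  "second_ff g N F u v w =
     orth_proj g (normal_space g N F u) (pullback_conn g N F (\<lambda>u'. deriv_at F u' w) u v)"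

definition shape_op ::
  "('e \<Rightarrow> 'e \<Rightarrow> real) \<Rightarrow> 'e set \<Rightarrow> ('m::euclidean_space \<Rightarrow> 'e::euclidean_space) \<Rightarrow>
   'm \<Rightarrow> 'e \<Rightarrow> 'm \<Rightarrow> 'm" where
  "shape_op g N F u \<xi> v =
     (THE a. \<forall>w. induced_metric g F u a w = g (second_ff g N F u v w) \<xi>)"

definition mean_curv ::
  "('e \<Rightarrow> 'e \<Rightarrow> real) \<Rightarrow> 'e set \<Rightarrow> ('m::euclidean_space \<Rightarrow> 'e::euclidean_space) \<Rightarrow> 'm \<Rightarrow> 'e" where
  "mean_curv g N F u =
     (1 / real DIM('m)) *\<^sub>R metric_trace (induced_metric g F u) (second_ff g N F u)"

definition normal_conn ::
  "('e \<Rightarrow> 'e \<Rightarrow> real) \<Rightarrow> 'e set \<Rightarrow> ('m::euclidean_space \<Rightarrow> 'e::euclidean_space) \<Rightarrow>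
   ('m \<Rightarrow> 'e) \<Rightarrow> 'm \<Rightarrow> 'm \<Rightarrow> 'e" where
  "normal_conn g N F \<xi> u v = orth_proj g (normal_space g N F u) (pullback_conn g N F \<xi> u v)"

text \<open>
  Levi-Civita connection of the induced metric on constant coordinate fields, by the Koszul formula
  (whose bracket terms vanish).
\<close>

definition levi_civita ::
  "('e \<Rightarrow> 'e \<Rightarrow> real) \<Rightarrow> ('m::euclidean_space \<Rightarrow> 'e::euclidean_space) \<Rightarrow> 'm \<Rightarrow> 'm \<Rightarrow> 'm \<Rightarrow> 'm" where
  "levi_civita g F u v w = (THE a. \<forall>z. 2 * induced_metric g F u a z =
       deriv_at (\<lambda>u'. induced_metric g F u' w z) u v
     + deriv_at (\<lambda>u'. induced_metric g F u' v z) u w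
     - deriv_at (\<lambda>u'. induced_metric g F u' v w) u z)"

definition rough_laplacian ::
  "('e \<Rightarrow> 'e \<Rightarrow> real) \<Rightarrow> 'e set \<Rightarrow> ('m::euclidean_space \<Rightarrow> 'e::euclidean_space) \<Rightarrow>
   ('m \<Rightarrow> 'e) \<Rightarrow> 'm \<Rightarrow> 'e" where
  "rough_laplacian g N F V u = metric_trace (induced_metric g F u)
     (\<lambda>v w. pullback_conn g N F (\<lambda>u'. pullback_conn g N F V u' w) u v
          - pullback_conn g N F V u (levi_civita g F u v w))"

definition tension ::
  "('e \<Rightarrow> 'e \<Rightarrow> real) \<Rightarrow> 'e set \<Rightarrow> ('m::euclidean_space \<Rightarrow> 'e::euclidean_space) \<Rightarrow> 'm \<Rightarrow> 'e" where
  "tension g N F u = real DIM('m) *\<^sub>R mean_curv g N F u"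

definition bitension ::
  "('e \<Rightarrow> 'e \<Rightarrow> real) \<Rightarrow> 'e set \<Rightarrow> ('m::euclidean_space \<Rightarrow> 'e::euclidean_space) \<Rightarrow> 'm \<Rightarrow> 'e" where
  "bitension g N F u = rough_laplacian g N F (tension g N F) u
     - metric_trace (induced_metric g F u)
         (\<lambda>v w. target_curvature g N (F u) (deriv_at F u v) (tension g N F u) (deriv_at F u w))"

text \<open>
  The coordinate vector of the tangent part \<open>T\<close> of \<open>d = \<partial>\<^sub>t\<close>: since \<open>d = F\<^sub>*T + \<eta>\<close>, it is
  determined by \<open>\<eta> = d - F\<^sub>*T\<close> being normal.
\<close>

definition tangent_part ::
  "('e \<Rightarrow> 'e \<Rightarrow> real) \<Rightarrow> 'e set \<Rightarrow> 'e \<Rightarrow> ('m::euclidean_space \<Rightarrow> 'e::euclidean_space) \<Rightarrow> 'm \<Rightarrow> 'm" where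
  "tangent_part g N d F u = (THE v. d - deriv_at F u v \<in> normal_space g N F u)"


section \<open>Immersions of manifolds\<close>

definition immersion ::
  "'e::euclidean_space set \<Rightarrow> 'p set \<Rightarrow> ('m::euclidean_space, 'p) atlas \<Rightarrow> ('p \<Rightarrow> 'e) \<Rightarrow> bool" where
  "immersion N M A f \<longleftrightarrow> f ` M \<subseteq> N \<and>
     (\<forall>(U, x)\<in>A. smooth_on U (f \<circ> x) \<and> (\<forall>u\<in>U. inj (deriv_at (f \<circ> x) u)))"

definition minimal ::
  "('e \<Rightarrow> 'e \<Rightarrow> real) \<Rightarrow> 'e::euclidean_space set \<Rightarrow> ('m::euclidean_space, 'p) atlas \<Rightarrow> ('p \<Rightarrow> 'e) \<Rightarrow> bool" where
  "minimal g N A f \<longleftrightarrow> (\<forall>(U, x)\<in>A. \<forall>u\<in>U. mean_curv g N (f \<circ> x) u = 0)"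

definition nonzero_parallel_mean_curv ::
  "('e \<Rightarrow> 'e \<Rightarrow> real) \<Rightarrow> 'e::euclidean_space set \<Rightarrow> ('m::euclidean_space, 'p) atlas \<Rightarrow> ('p \<Rightarrow> 'e) \<Rightarrow> bool" where
  "nonzero_parallel_mean_curv g N A f \<longleftrightarrow> (\<forall>(U, x)\<in>A. \<forall>u\<in>U.
     mean_curv g N (f \<circ> x) u \<noteq> 0 \<and>
     (\<forall>v. normal_conn g N (f \<circ> x) (mean_curv g N (f \<circ> x)) u v = 0))"

definition biconservative ::
  "('e \<Rightarrow> 'e \<Rightarrow> real) \<Rightarrow> 'e::euclidean_space set \<Rightarrow> ('m::euclidean_space, 'p) atlas \<Rightarrow> ('p \<Rightarrow> 'e) \<Rightarrow> bool" where
  "biconservative g N A f \<longleftrightarrow> (\<forall>(U, x)\<in>A. \<forall>u\<in>U.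
     orth_proj g (range (deriv_at (f \<circ> x) u)) (bitension g N (f \<circ> x) u) = 0)"

definition nowhere_zero_tangent_part ::
  "('e \<Rightarrow> 'e \<Rightarrow> real) \<Rightarrow> 'e::euclidean_space set \<Rightarrow> 'e \<Rightarrow> ('m::euclidean_space, 'p) atlas \<Rightarrow>
   ('p \<Rightarrow> 'e) \<Rightarrow> bool" where
  "nowhere_zero_tangent_part g N d A f \<longleftrightarrow>
     (\<forall>(U, x)\<in>A. \<forall>u\<in>U. tangent_part g N d (f \<circ> x) u \<noteq> 0)"

text \<open>\<open>T\<close> is required to be an eigenvector in the strict sense, i.e. nonzero.\<close>

definition class_A ::
  "('e \<Rightarrow> 'e \<Rightarrow> real) \<Rightarrow> 'e::euclidean_space set \<Rightarrow> 'e \<Rightarrow> 'p set \<Rightarrow> ('m::euclidean_space, 'p) atlas \<Rightarrow>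
   ('p \<Rightarrow> 'e) \<Rightarrow> bool" where
  "class_A g N d M A f \<longleftrightarrow> immersion N M A f \<and>
     (\<forall>(U, x)\<in>A. \<forall>u\<in>U. \<forall>\<xi>\<in>normal_space g N (f \<circ> x) u.
        let T = tangent_part g N d (f \<circ> x) u in
          T \<noteq> 0 \<and> (\<exists>\<kappa>. shape_op g N (f \<circ> x) u \<xi> T = \<kappa> *\<^sub>R T))"


section \<open>The products of space forms with the real line\<close>

text \<open>
  \<open>\<epsilon>\<close> is \<open>1\<close> or \<open>-1\<close>. The form \<open>E3_form \<epsilon>\<close> is Euclidean or Lorentzian accordingly. In the
  hyperbolic case the component with positive time coordinate is chosen.
\<close>

definition E3_form :: "real \<Rightarrow> (real^3) \<Rightarrow> (real^3) \<Rightarrow> real" where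
  "E3_form \<epsilon> x y = \<epsilon> * (x $ 1 * y $ 1) + x $ 2 * y $ 2 + x $ 3 * y $ 3"

definition Q4 :: "real \<Rightarrow> ((real^2) \<times> (real^3)) set" where
  "Q4 \<epsilon> = {(z, x). z \<bullet> z + E3_form \<epsilon> x x = \<epsilon> \<and> (\<epsilon> = -1 \<longrightarrow> x $ 1 > 0)}"

definition circle_pt :: "real \<Rightarrow> real \<Rightarrow> real^2" where
  "circle_pt b s = vector [b * cos (s / b), b * sin (s / b)]"

text \<open>The space form \<open>\<rat>\<^sup>2\<^sub>a\<close>; it depends only on \<open>\<epsilon>\<close> and \<open>b\<close>.\<close>

definition Q2 :: "real \<Rightarrow> real \<Rightarrow> (real^3) set" where
  "Q2 \<epsilon> b = {x. \<forall>s. (circle_pt b s, x) \<in> Q4 \<epsilon>}"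

definition E4_form :: "real \<Rightarrow> (real^3) \<times> real \<Rightarrow> (real^3) \<times> real \<Rightarrow> real" where
  "E4_form \<epsilon> = (\<lambda>(x, t) (x', t'). E3_form \<epsilon> x x' + t * t')"

definition E6_form ::
  "real \<Rightarrow> (real^2) \<times> (real^3) \<times> real \<Rightarrow> (real^2) \<times> (real^3) \<times> real \<Rightarrow> real" where
  "E6_form \<epsilon> = (\<lambda>(z, x, t) (z', x', t'). z \<bullet> z' + E3_form \<epsilon> x x' + t * t')"

definition Q4_R :: "real \<Rightarrow> ((real^2) \<times> (real^3) \<times> real) set" where
  "Q4_R \<epsilon> = {(z, x, t). (z, x) \<in> Q4 \<epsilon>}"

definition Q2_R :: "real \<Rightarrow> real \<Rightarrow> ((real^3) \<times> real) set" where
  "Q2_R \<epsilon> b = Q2 \<epsilon> b \<times> UNIV"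

definition dt6 :: "(real^2) \<times> (real^3) \<times> real" where "dt6 = (0, 0, 1)"

definition dt4 :: "(real^3) \<times> real" where "dt4 = (0, 1)"

end

theory Submission
  imports Defs
begin

text \<open>
  The normal space of \<open>f\<close> is spanned by the normal \<open>n\<close> of \<open>\<phi>\<close> and by the normal \<open>Z\<close> of the
  hypersurface \<open>S\<^sup>1(b) \<times> \<rat>\<^sup>2\<^sub>a \<times> \<real>\<close>. As \<open>\<phi>\<close> is minimal, \<open>H = k Z\<close> with \<open>k \<noteq> 0\<close>. The component of
  \<open>\<nabla>\<^sub>vH\<close> along \<open>n\<close> is \<open>k b\<^sup>2 \<langle>v, \<partial>\<^sub>t\<rangle> \<langle>n, \<partial>\<^sub>t\<rangle>\<close>, so \<open>\<nabla>\<^sup>\<bottom>H = 0\<close> and \<open>T\<^sub>\<phi> \<noteq> 0\<close> force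
  \<open>\<langle>n, \<partial>\<^sub>t\<rangle> = 0\<close>. Hence \<open>\<partial>\<^sub>t = f\<^sub>*T\<close> is tangent, and differentiating this constant gives
  \<open>\<alpha>(v, T) = 0\<close>: all shape operators annihilate \<open>T\<close>.
\<close>

section \<open>Traces and orthogonal projections\<close>

text \<open>For \<open>\<epsilon> = -1\<close> the ambient form is Lorentzian and definite only on
  tangent spaces, so projections and traces are built for a form that is positive on a subspace. The
  derivative of \<open>H\<close> sees only heights because \<open>Z\<close> is a linear map of the
  position vector, with weight \<open>-(b\<^sup>2)\<close> on the coordinates in
  \<open>real^3\<close> and \<open>0\<close> on the line. Its derivative along \<open>v\<close>,
  paired with \<open>n\<close>, is \<open>-(b\<^sup>2)\<close> times the pairing of the
  \<open>real^3\<close> parts, and orthogonality of \<open>v\<close> and \<open>n\<close> trades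
  that pairing for minus the product of the heights. The derivative of \<open>k\<close> multiplies
  \<open>Z\<close> and drops out against \<open>n\<close>, but it has to exist: \<open>k\<close>
  contains the squared length of \<open>T\<close>, and \<open>T\<close> is only described point by
  point. Cramer's rule for the Gram system makes \<open>T\<close> differentiable, which
  differentiating the constant field at the end requires as well. A chart of \<open>M\<close> need
  not respect the product. Instead of proving that curvature and tangent parts are independent of
  the parametrization, the given chart is kept and the splitting is carried by a transition map
  \<open>\<theta>\<close>.\<close>

definition symmetric_form :: "('e::real_vector \<Rightarrow> 'e \<Rightarrow> real) \<Rightarrow> bool" where
  "symmetric_form g \<longleftrightarrow> bilinear g \<and> (\<forall>v w. g v w = g w v)"

definition pos_def_on :: "'e::real_vector set \<Rightarrow> ('e \<Rightarrow> 'e \<Rightarrow> real) \<Rightarrow> bool" where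
  "pos_def_on S g \<longleftrightarrow> (\<forall>v\<in>S. v \<noteq> 0 \<longrightarrow> g v v > 0)"

definition orthonormal :: "('e \<Rightarrow> 'e \<Rightarrow> real) \<Rightarrow> 'e set \<Rightarrow> bool" where
  "orthonormal g E \<longleftrightarrow> finite E \<and> (\<forall>e\<in>E. \<forall>e'\<in>E. g e e' = (if e = e' then 1 else 0))"

lemma symmetric_formD:
  assumes "symmetric_form g"
  shows "bilinear g" "g v w = g w v" "linear (g v)" "linear (\<lambda>v. g v w)"
  using assms unfolding symmetric_form_def bilinear_def by auto

lemma symmetric_form_simps:
  assumes "symmetric_form g"
  shows "g (a + b) w = g a w + g b w" "g (a - b) w = g a w - g b w" "g (r *\<^sub>R a) w = r * g a w"
    "g 0 w = 0" "g (- a) w = - g a w" "g (\<Sum>i\<in>I. x i) w = (\<Sum>i\<in>I. g (x i) w)"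
    "g w (a + b) = g w a + g w b" "g w (a - b) = g w a - g w b" "g w (r *\<^sub>R a) = r * g w a"
    "g w 0 = 0" "g w (- a) = - g w a" "g w (\<Sum>i\<in>I. x i) = (\<Sum>i\<in>I. g w (x i))"
proof -
  have l: "linear (g w)" "linear (\<lambda>v. g v w)" using symmetric_formD(3,4)[OF assms] by auto
  show "g (a + b) w = g a w + g b w" "g (a - b) w = g a w - g b w" "g (r *\<^sub>R a) w = r * g a w"
    "g 0 w = 0" "g (- a) w = - g a w" "g (\<Sum>i\<in>I. x i) w = (\<Sum>i\<in>I. g (x i) w)"
    using linear_add[OF l(2)] linear_diff[OF l(2)] linear_scale[OF l(2)] linear_0[OF l(2)]
      linear_neg[OF l(2)] linear_sum[OF l(2)] by simp_all
  show "g w (a + b) = g w a + g w b" "g w (a - b) = g w a - g w b" "g w (r *\<^sub>R a) = r * g w a"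
    "g w 0 = 0" "g w (- a) = - g w a" "g w (\<Sum>i\<in>I. x i) = (\<Sum>i\<in>I. g w (x i))"
    using linear_add[OF l(1)] linear_diff[OF l(1)] linear_scale[OF l(1)] linear_0[OF l(1)]
      linear_neg[OF l(1)] linear_sum[OF l(1)] by simp_all
qed

lemma pos_def_on_mono: "pos_def_on S g \<Longrightarrow> S' \<subseteq> S \<Longrightarrow> pos_def_on S' g"
  unfolding pos_def_on_def by blast

lemma pos_def_onD: "pos_def_on S g \<Longrightarrow> v \<in> S \<Longrightarrow> g v v = 0 \<Longrightarrow> v = 0"
  unfolding pos_def_on_def by force

lemma orthonormal_coeff:
  assumes "symmetric_form g" "orthonormal g E" "e \<in> E"
  shows "g (\<Sum>e'\<in>E. c e' *\<^sub>R e') e = c e"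
proof -
  have "g (\<Sum>e'\<in>E. c e' *\<^sub>R e') e = (\<Sum>e'\<in>E. c e' * (if e' = e then 1 else 0))"
    unfolding symmetric_form_simps[OF assms(1)]
    by (rule sum.cong) (use assms in \<open>auto simp: orthonormal_def\<close>)
  also have "\<dots> = c e"
    using assms by (simp add: orthonormal_def if_distrib cong: if_cong)
  finally show ?thesis .
qed

lemma orthonormal_expansion:
  assumes "symmetric_form g" "orthonormal g E" "v \<in> span E"
  shows "v = (\<Sum>e\<in>E. g v e *\<^sub>R e)"
proof -
  have "finite E" using assms by (simp add: orthonormal_def)
  then obtain c where c: "v = (\<Sum>e\<in>E. c e *\<^sub>R e)" using assms(3) by (auto simp: span_finite)
  have "g v e = c e" if "e \<in> E" for e
    unfolding c by (rule orthonormal_coeff[OF assms(1,2) that])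
  then have "(\<Sum>e\<in>E. g v e *\<^sub>R e) = (\<Sum>e\<in>E. c e *\<^sub>R e)" by (intro sum.cong) auto
  then show ?thesis using c by metis
qed

lemma orthonormal_parseval:
  assumes "symmetric_form g" "orthonormal g E" "v \<in> span E"
  shows "g v w = (\<Sum>e\<in>E. g v e * g w e)"
proof -
  have "g v w = g (\<Sum>e\<in>E. g v e *\<^sub>R e) w" using orthonormal_expansion[OF assms] by simp
  also have "\<dots> = (\<Sum>e\<in>E. g v e * g w e)"
    unfolding symmetric_form_simps[OF assms(1)] using symmetric_formD(2)[OF assms(1)] by simp
  finally show ?thesis .
qed

lemma orthonormal_independent:
  assumes "symmetric_form g" "orthonormal g E"
  shows "independent E"
proof -
  have "finite E" using assms by (simp add: orthonormal_def)
  moreover have "\<forall>e\<in>E. c e = 0" if "(\<Sum>e\<in>E. c e *\<^sub>R e) = 0" for c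
    using orthonormal_coeff[OF assms] that symmetric_form_simps(4)[OF assms(1)] by metis
  ultimately show ?thesis by (auto simp: dependent_finite)
qed

text \<open>The only division is by \<open>g p p\<close> with \<open>p\<close> in the span, so
  positivity there suffices and \<open>g\<close> may be indefinite elsewhere. A vector depending on
  the earlier ones leaves \<open>p = 0\<close> and is dropped.\<close>

lemma gram_schmidt_finite:
  assumes g: "symmetric_form g" and "finite B" and "pos_def_on (span B) g"
  shows "\<exists>E. orthonormal g E \<and> span E = span B"
  using assms(2,3)
proof (induction B rule: finite_induct)
  case empty
  show ?case by (rule exI[of _ "{}"]) (simp add: orthonormal_def)
next
  case (insert b B)
  have "pos_def_on (span B) g"
    using insert.prems by (rule pos_def_on_mono) (simp add: span_mono subset_insertI)
  then obtain E where E: "orthonormal g E" "span E = span B" using insert.IH by blast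
  define p where "p = b - (\<Sum>e\<in>E. g b e *\<^sub>R e)"
  have q: "(\<Sum>e\<in>E. g b e *\<^sub>R e) \<in> span (insert x E)" for x
    by (intro span_sum span_scale span_base insertI2)
  have sp: "span (insert b B) = span (insert p E)"
  proof -
    have "span (insert b B) = span (insert b E)"
      unfolding span_insert E(2) ..
    also have "\<dots> = span (insert p E)"
    proof -
      have "p + (\<Sum>e\<in>E. g b e *\<^sub>R e) \<in> span (insert p E)"
        by (intro span_add[OF _ q] span_base insertI1)
      then have 1: "b \<in> span (insert p E)" by (simp add: p_def)
      have 2: "p \<in> span (insert b E)"
        unfolding p_def by (intro span_diff[OF _ q] span_base insertI1)
      show ?thesis
        unfolding span_eq using 1 2 by (auto simp: span_base)
    qed
    finally show ?thesis .
  qed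
  have orth: "g p e = 0" if "e \<in> E" for e
    using orthonormal_coeff[OF g E(1) that, of "g b"]
    by (simp add: p_def symmetric_form_simps[OF g])
  show ?case
  proof (cases "p = 0")
    case True
    then show ?thesis using sp E by (intro exI[of _ E]) (simp add: span_insert_0)
  next
    case False
    have "p \<in> span (insert b B)" unfolding sp by (simp add: span_base)
    then have pos: "g p p > 0" using insert.prems False by (simp add: pos_def_on_def)
    define r where "r = 1 / sqrt (g p p)"
    have r: "r \<noteq> 0" "r * (r * g p p) = 1"
      using pos by (auto simp: r_def field_simps)
    \<comment> \<open>Orthonormality is indexed by the vectors themselves, so the new vector has to
      differ from the old ones; if it did not, \<open>p\<close> would be orthogonal to
      itself.\<close>
    have "r *\<^sub>R p \<notin> E"
      using orth[of "r *\<^sub>R p"] r pos by (auto simp: symmetric_form_simps[OF g])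
    then have "orthonormal g (insert (r *\<^sub>R p) E)"
      using E(1) orth r symmetric_formD(2)[OF g] unfolding orthonormal_def
      by (auto simp: symmetric_form_simps[OF g])
    moreover have "span (insert (r *\<^sub>R p) E) = span (insert p E)"
    proof -
      have "(1 / r) *\<^sub>R (r *\<^sub>R p) \<in> span (insert (r *\<^sub>R p) E)"
        by (intro span_scale span_base insertI1)
      then have 1: "p \<in> span (insert (r *\<^sub>R p) E)" using r by simp
      have 2: "r *\<^sub>R p \<in> span (insert p E)" by (intro span_scale span_base insertI1)
      show ?thesis unfolding span_eq using 1 2 by (auto simp: span_base)
    qed
    ultimately show ?thesis using sp by metis
  qed
qed

lemma gram_schmidt:
  fixes g :: "'e::euclidean_space \<Rightarrow> 'e \<Rightarrow> real"
  assumes "symmetric_form g" "subspace S" "pos_def_on S g"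
  obtains E where "orthonormal g E" "span E = S"
proof -
  obtain B where B: "B \<subseteq> S" "independent B" "S \<subseteq> span B" "card B = dim S"
    using basis_exists by blast
  have "span B = S" using B assms(2) by (metis span_minimal subset_antisym)
  then show ?thesis
    using gram_schmidt_finite[OF assms(1) independent_imp_finite[OF B(2)]] assms(3) that by auto
qed

text \<open>Two candidates differ by a vector of \<open>S\<close> with zero square, so definiteness
  on \<open>S\<close> alone makes the description in \<open>orth_proj\<close> unique.\<close>

lemma orth_proj_eqI:
  fixes g :: "'e::euclidean_space \<Rightarrow> 'e \<Rightarrow> real"
  assumes g: "symmetric_form g" "subspace S" "pos_def_on S g"
    and p: "p \<in> S" "\<And>w. w \<in> S \<Longrightarrow> g (v - p) w = 0"
  shows "orth_proj g S v = p"
  unfolding orth_proj_def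
proof (rule the_equality)
  fix q assume q: "q \<in> S \<and> (\<forall>w\<in>S. g (v - q) w = 0)"
  have "q - p \<in> S" using p(1) q g(2) by (simp add: subspace_diff)
  moreover have "g (q - p) (q - p) = g (v - p) (q - p) - g (v - q) (q - p)"
    by (simp add: symmetric_form_simps[OF g(1)])
  then have "g (q - p) (q - p) = 0" using p(2) q calculation by simp
  ultimately show "q = p" using pos_def_onD[OF g(3)] by force
qed (use p in auto)

lemma orth_proj_props:
  fixes g :: "'e::euclidean_space \<Rightarrow> 'e \<Rightarrow> real"
  assumes g: "symmetric_form g" "subspace S" "pos_def_on S g"
  shows "orth_proj g S v \<in> S" "w \<in> S \<Longrightarrow> g (orth_proj g S v) w = g v w"
proof -
  obtain E where E: "orthonormal g E" "span E = S" using gram_schmidt[OF g] .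
  define p where "p = (\<Sum>e\<in>E. g v e *\<^sub>R e)"
  have p: "p \<in> S" unfolding p_def E(2)[symmetric] by (intro span_sum span_scale span_base)
  have *: "g p w = g v w" if "w \<in> S" for w
  proof -
    have "g v w = g v (\<Sum>e\<in>E. g w e *\<^sub>R e)"
      using orthonormal_expansion[OF g(1) E(1), of w] that E(2) by simp
    also have "\<dots> = g p w"
      unfolding p_def symmetric_form_simps[OF g(1)] using symmetric_formD(2)[OF g(1)]
      by (simp add: mult.commute)
    finally show ?thesis by simp
  qed
  have "orth_proj g S v = p"
    by (rule orth_proj_eqI[OF g p]) (simp add: symmetric_form_simps[OF g(1)] *)
  then show "orth_proj g S v \<in> S" "w \<in> S \<Longrightarrow> g (orth_proj g S v) w = g v w"
    using p * by auto
qed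

section \<open>Traces with respect to an inner product\<close>

lemma orthonormal_basisD:
  fixes h :: "'m::euclidean_space \<Rightarrow> 'm \<Rightarrow> real"
  assumes "orthonormal_basis h E"
  shows "orthonormal h E" "span E = UNIV" "card E = DIM('m)"
  using assms by (simp_all add: orthonormal_basis_def orthonormal_def)

text \<open>An orthonormal basis exists, so the \<open>SOME\<close> in \<open>metric_trace\<close>
  denotes one; the choice depends on \<open>h\<close> only, hence the same \<open>E\<close> computes
  the trace of every \<open>\<beta>\<close>.\<close>

lemma metric_trace_obtain:
  fixes h :: "'m::euclidean_space \<Rightarrow> 'm \<Rightarrow> real"
  assumes h: "symmetric_form h" "pos_def_on UNIV h"
  obtains E where "orthonormal h E" "span E = UNIV" "card E = DIM('m)"
    "\<And>\<beta>::'m \<Rightarrow> 'm \<Rightarrow> 'e::real_vector. metric_trace h \<beta> = (\<Sum>e\<in>E. \<beta> e e)"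
proof -
  obtain E where E: "orthonormal h E" "span E = UNIV"
    using gram_schmidt[OF h(1) subspace_UNIV h(2)] .
  then have "card E = DIM('m)"
    using orthonormal_independent[OF h(1) E(1)] dim_span_eq_card_independent by (metis dim_UNIV)
  then have "orthonormal_basis h E" using E by (simp add: orthonormal_basis_def orthonormal_def)
  then have *: "orthonormal_basis h (SOME E. orthonormal_basis h E)" by (rule someI)
  show ?thesis
    by (rule that[OF orthonormal_basisD[OF *]]) (simp only: metric_trace_def Let_def)
qed

text \<open>Parseval's identity, in the form that evaluates the rank-one terms of a second
  fundamental form.\<close>

lemma metric_trace_squares:
  fixes h :: "'m::euclidean_space \<Rightarrow> 'm \<Rightarrow> real"
  assumes h: "symmetric_form h" "pos_def_on UNIV h"
  shows "metric_trace h (\<lambda>v w. h v a * h w b) = h a b"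
proof -
  obtain E where E: "orthonormal h E" "span E = UNIV" "card E = DIM('m)"
    "\<And>\<beta>::'m \<Rightarrow> 'm \<Rightarrow> real. metric_trace h \<beta> = (\<Sum>e\<in>E. \<beta> e e)"
    using metric_trace_obtain[OF h] by metis
  then show ?thesis
    using orthonormal_parseval[OF h(1) E(1), of a b] symmetric_formD(2)[OF h(1)] by simp
qed

lemma metric_trace_self:
  fixes h :: "'m::euclidean_space \<Rightarrow> 'm \<Rightarrow> real"
  assumes h: "symmetric_form h" "pos_def_on UNIV h"
  shows "metric_trace h h = real DIM('m)"
proof -
  obtain E where E: "orthonormal h E" "span E = UNIV" "card E = DIM('m)"
    "\<And>\<beta>::'m \<Rightarrow> 'm \<Rightarrow> real. metric_trace h \<beta> = (\<Sum>e\<in>E. \<beta> e e)"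
    using metric_trace_obtain[OF h] by metis
  then show ?thesis by (simp add: orthonormal_def)
qed

lemma metric_trace_linear:
  shows "linear L \<Longrightarrow> metric_trace h (\<lambda>v w. L (\<beta> v w)) = L (metric_trace h \<beta>)"
    "metric_trace h (\<lambda>v w. \<gamma> v w + \<delta> v w) = metric_trace h \<gamma> + metric_trace h \<delta>"
    "metric_trace h (\<lambda>v w. (r::real) * \<eta> v w) = r * metric_trace h \<eta>"
  by (simp_all add: metric_trace_def Let_def linear_sum sum.distrib sum_distrib_left)

text \<open>\<open>P\<close> models the differential of a Riemannian submersion, with
  \<open>l\<close> the horizontal lift. The coefficients of \<open>P v\<close> in \<open>E'\<close>
  are the products of \<open>v\<close> with the lifts, and Parseval in \<open>E\<close> turns the
  sum over \<open>E\<close> into products of lifts, which are orthonormal. So the basis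
  \<open>E\<close> chosen by the trace need not be adapted to the splitting into horizontal and
  vertical vectors.\<close>

lemma metric_trace_riemannian_submersion:
  fixes h :: "'m::euclidean_space \<Rightarrow> 'm \<Rightarrow> real" and h' :: "'n::euclidean_space \<Rightarrow> 'n \<Rightarrow> real"
  assumes h: "symmetric_form h" "pos_def_on UNIV h"
    and h': "symmetric_form h'" "pos_def_on UNIV h'"
    and lift: "\<And>w. \<exists>v. P v = w \<and> (\<forall>v'. h v v' = h' w (P v'))"
    and \<beta>: "bilinear \<beta>"
  shows "metric_trace h (\<lambda>v w. \<beta> (P v) (P w)) = (metric_trace h' \<beta> :: real)"
proof -
  obtain E where E: "orthonormal h E" "span E = UNIV" "card E = DIM('m)"
    "\<And>\<beta>::'m \<Rightarrow> 'm \<Rightarrow> real. metric_trace h \<beta> = (\<Sum>e\<in>E. \<beta> e e)"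
    using metric_trace_obtain[OF h] by metis
  obtain E' where E': "orthonormal h' E'" "span E' = UNIV" "card E' = DIM('n)"
    "\<And>\<beta>::'n \<Rightarrow> 'n \<Rightarrow> real. metric_trace h' \<beta> = (\<Sum>e\<in>E'. \<beta> e e)"
    using metric_trace_obtain[OF h'] by metis
  obtain l where l: "\<And>w. P (l w) = w" "\<And>w v'. h (l w) v' = h' w (P v')"
    using lift by metis
  have ex: "\<beta> (P v) (P v) = (\<Sum>i\<in>E'. \<Sum>j\<in>E'. h (l i) v * h (l j) v * \<beta> i j)" for v
  proof -
    have *: "P v = (\<Sum>i\<in>E'. h (l i) v *\<^sub>R i)"
      using orthonormal_expansion[OF h'(1) E'(1), of "P v"] E'(2) l(2)
        symmetric_formD(2)[OF h'(1)] by simp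
    have lin: "linear (\<lambda>x. \<beta> x y)" "linear (\<beta> x)" for x y using \<beta> by (auto simp: bilinear_def)
    have "\<beta> (P v) (P v) = (\<Sum>j\<in>E'. \<Sum>i\<in>E'. h (l i) v * h (l j) v * \<beta> i j)"
      by (subst (1 2) *)
        (simp add: linear_sum[OF lin(1)] linear_sum[OF lin(2)] linear_scale[OF lin(1)]
          linear_scale[OF lin(2)] sum_distrib_left mult.assoc mult.left_commute)
    then show ?thesis by (subst sum.swap)
  qed
  have "metric_trace h (\<lambda>v w. \<beta> (P v) (P w))
      = (\<Sum>i\<in>E'. \<Sum>j\<in>E'. (\<Sum>e\<in>E. h (l i) e * h (l j) e) * \<beta> i j)"
    unfolding E(4) ex sum_distrib_right
    by (subst sum.swap) (intro sum.cong refl, rule sum.swap)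
  also have "\<dots> = (\<Sum>i\<in>E'. \<Sum>j\<in>E'. h' i j * \<beta> i j)"
  proof -
    have "h' i j = (\<Sum>e\<in>E. h (l i) e * h (l j) e)" for i j
      using orthonormal_parseval[OF h(1) E(1), of "l i" "l j"] E(2) l by simp
    then show ?thesis by simp
  qed
  also have "\<dots> = (\<Sum>i\<in>E'. \<Sum>j\<in>E'. (if i = j then \<beta> i j else 0))"
    using E'(1) by (intro sum.cong refl) (auto simp: orthonormal_def)
  also have "\<dots> = metric_trace h' \<beta>"
    using E'(1) unfolding E'(4) by (simp add: orthonormal_def)
  finally show ?thesis .
qed


section \<open>Second derivatives\<close>

abbreviation hess :: "('a::real_normed_vector \<Rightarrow> 'b::real_normed_vector) \<Rightarrow> 'a \<Rightarrow> 'a \<Rightarrow> 'a \<Rightarrow> 'b" where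
  "hess F u v w \<equiv> deriv_at (\<lambda>u'. deriv_at F u' w) u v"

definition twice_diff_on :: "'a::real_normed_vector set \<Rightarrow> ('a \<Rightarrow> 'b::real_normed_vector) \<Rightarrow> bool" where
  "twice_diff_on U F \<longleftrightarrow> open U \<and>
     (\<forall>u\<in>U. F differentiable (at u) \<and> (\<forall>v. (\<lambda>u. deriv_at F u v) differentiable (at u)))"

lemma twice_diff_onD:
  assumes "twice_diff_on U F"
  shows "open U" "u \<in> U \<Longrightarrow> F differentiable (at u)" "u \<in> U \<Longrightarrow> linear (deriv_at F u)"
    "u \<in> U \<Longrightarrow> (F has_derivative deriv_at F u) (at u)"
    "u \<in> U \<Longrightarrow> (\<lambda>u. deriv_at F u v) differentiable (at u)"
    "u \<in> U \<Longrightarrow> ((\<lambda>u. deriv_at F u v) has_derivative (\<lambda>w. hess F u w v)) (at u)"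
  using assms by (auto simp: twice_diff_on_def linear_frechet_derivative
      simp flip: frechet_derivative_works)

lemma smooth_on_imp_twice_diff_on:
  assumes "open U" "smooth_on U F"
  shows "twice_diff_on U F"
proof -
  have "ck_on (Suc (Suc 0)) U F" using assms(2) unfolding smooth_on_def by blast
  then show ?thesis using assms(1) by (auto simp: twice_diff_on_def)
qed

lemma deriv_at_eqI: "(F has_derivative F') (at u) \<Longrightarrow> deriv_at F u = F'"
  using frechet_derivative_at by metis

lemma deriv_at_cong_ev:
  assumes "\<forall>\<^sub>F u' in nhds u. F u' = G u'"
  shows "deriv_at F u = deriv_at G u" "F differentiable (at u) \<longleftrightarrow> G differentiable (at u)"
proof -
  have "(F has_derivative D) (at u) \<longleftrightarrow> (G has_derivative D) (at u)" for D
    using assms has_derivative_transform_eventually[of F D u UNIV G]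
      has_derivative_transform_eventually[of G D u UNIV F]
    by (auto simp: eventually_nhds_conv_at eq_commute)
  then show "deriv_at F u = deriv_at G u" "F differentiable (at u) \<longleftrightarrow> G differentiable (at u)"
    by (simp_all add: frechet_derivative_def differentiable_def)
qed

lemma eventually_nhds_openI: "open U \<Longrightarrow> u \<in> U \<Longrightarrow> (\<And>x. x \<in> U \<Longrightarrow> P x) \<Longrightarrow> \<forall>\<^sub>F x in nhds u. P x"
  using eventually_nhds by blast

text \<open>The mean value theorem in direction \<open>v\<close> reduces the second difference to a
  difference of two values of the derivative along \<open>v\<close>; both are expanded to first
  order at \<open>u\<close>. Differentiability of that derivative at the single point
  \<open>u\<close> is enough here, without continuity of second derivatives.\<close>

lemma second_difference_estimate:
  fixes F :: "'a::real_normed_vector \<Rightarrow> real"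
  assumes F: "twice_diff_on U F" and u: "u \<in> U" and e: "e > 0"
  shows "\<exists>d>0. \<forall>s. 0 < s \<and> s < d \<longrightarrow>
    \<bar>F (u + s *\<^sub>R v + s *\<^sub>R w) - F (u + s *\<^sub>R v) - F (u + s *\<^sub>R w) + F u - s\<^sup>2 * hess F u w v\<bar> \<le> e * s\<^sup>2"
proof -
  let ?K = "norm v + norm w + 1"
  \<comment> \<open>\<open>?K\<close> bounds displacements by \<open>s * ?K\<close>, its summand 1
    keeping it positive; the factor 2 pays for the two expansions, at \<open>r = s\<close> and at
    \<open>r = 0\<close>.\<close>
  define e' where "e' = e / (2 * ?K)"
  have K: "?K > 0" by (smt (verit) norm_ge_zero)
  have e': "e' > 0" using e K by (simp add: e'_def)
  have lin: "linear (\<lambda>w. hess F u w v)"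
    using twice_diff_onD(5)[OF F u, of v] by (rule linear_frechet_derivative)
  obtain d1 where d1: "d1 > 0"
    "\<And>y. norm (y - u) < d1 \<Longrightarrow>
      norm (deriv_at F y v - deriv_at F u v - hess F u (y - u) v) \<le> e' * norm (y - u)"
    using twice_diff_onD(6)[OF F u, of v] e' unfolding has_derivative_at_alt by blast
  obtain d2 where d2: "d2 > 0" "ball u d2 \<subseteq> U"
    using twice_diff_onD(1)[OF F] u openE by blast
  define d where "d = min d1 d2 / ?K"
  have "d > 0" using d1 d2 K by (simp add: d_def)
  moreover have "\<bar>F (u + s *\<^sub>R v + s *\<^sub>R w) - F (u + s *\<^sub>R v) - F (u + s *\<^sub>R w) + F u
      - s\<^sup>2 * hess F u w v\<bar> \<le> e * s\<^sup>2" if s: "0 < s" "s < d" for s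
  proof -
    have sK: "s * ?K < min d1 d2" using s K by (simp add: d_def field_simps)
    have nrm: "norm (x *\<^sub>R v + r *\<^sub>R w) \<le> s * ?K" if "0 \<le> x" "x \<le> s" "0 \<le> r" "r \<le> s" for x r
    proof -
      have "norm (x *\<^sub>R v + r *\<^sub>R w) \<le> x * norm v + r * norm w"
        using norm_triangle_ineq[of "x *\<^sub>R v" "r *\<^sub>R w"] that by simp
      also have "\<dots> \<le> s * norm v + s * norm w"
        using that by (intro add_mono mult_right_mono) auto
      also have "\<dots> \<le> s * ?K" using s by (simp add: algebra_simps)
      finally show ?thesis .
    qed
    have inU: "u + (x *\<^sub>R v + r *\<^sub>R w) \<in> U" if "0 \<le> x" "x \<le> s" "0 \<le> r" "r \<le> s" for x r
    proof (rule subsetD[OF d2(2)])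
      have "dist (u + (x *\<^sub>R v + r *\<^sub>R w)) u < d2" using nrm[OF that] sK by (simp add: dist_norm)
      then show "u + (x *\<^sub>R v + r *\<^sub>R w) \<in> ball u d2" by (simp add: dist_commute)
    qed
    define G where "G = (\<lambda>x. F (u + (x *\<^sub>R v + s *\<^sub>R w)) - F (u + (x *\<^sub>R v + 0 *\<^sub>R w)))"
    define G' where "G' = (\<lambda>x. deriv_at F (u + (x *\<^sub>R v + s *\<^sub>R w)) v - deriv_at F (u + (x *\<^sub>R v + 0 *\<^sub>R w)) v)"
    have path: "((\<lambda>x. F (u + (x *\<^sub>R v + r *\<^sub>R w))) has_real_derivative
        deriv_at F (u + (x *\<^sub>R v + r *\<^sub>R w)) v) (at x)" if "0 \<le> x" "x \<le> s" "0 \<le> r" "r \<le> s" for x r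
    proof -
      have "((\<lambda>x. u + (x *\<^sub>R v + r *\<^sub>R w)) has_derivative (\<lambda>t. t *\<^sub>R v)) (at x)"
        by (auto intro!: derivative_eq_intros)
      from has_derivative_compose[OF this twice_diff_onD(4)[OF F inU[OF that]]]
      show ?thesis
        using linear_scale[OF twice_diff_onD(3)[OF F inU[OF that]]]
        by (simp add: has_field_derivative_def mult.commute[of _ "deriv_at F _ _"])
    qed
    have "\<exists>z>0. z < s \<and> G s - G 0 = (s - 0) * G' z"
    proof (rule MVT2[OF s(1)])
      fix x assume "0 \<le> x" "x \<le> s"
      then show "DERIV G x :> G' x"
        unfolding G_def G'_def by (intro DERIV_diff path) (use s in auto)
    qed
    then obtain z where z: "0 < z" "z < s" "G s - G 0 = s * G' z" by auto
    have est: "\<bar>deriv_at F (u + (z *\<^sub>R v + r *\<^sub>R w)) v - deriv_at F u v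
        - hess F u (z *\<^sub>R v + r *\<^sub>R w) v\<bar> \<le> e' * (s * ?K)" if "0 \<le> r" "r \<le> s" for r
    proof -
      have n: "norm (z *\<^sub>R v + r *\<^sub>R w) \<le> s * ?K" using z that by (intro nrm) auto
      have "\<bar>deriv_at F (u + (z *\<^sub>R v + r *\<^sub>R w)) v - deriv_at F u v
        - hess F u (z *\<^sub>R v + r *\<^sub>R w) v\<bar> \<le> e' * norm (z *\<^sub>R v + r *\<^sub>R w)"
        using d1(2)[of "u + (z *\<^sub>R v + r *\<^sub>R w)"] n sK by simp
      also have "\<dots> \<le> e' * (s * ?K)" using n e' by (intro mult_left_mono) auto
      finally show ?thesis .
    qed
    have "\<bar>G' z - s * hess F u w v\<bar> \<le> e' * (s * ?K) + e' * (s * ?K)"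
      using est[of s] est[of 0] s
      by (simp add: G'_def linear_add[OF lin] linear_scale[OF lin] linear_0[OF lin])
    also have "\<dots> = s * (2 * ?K * e')" by (simp add: algebra_simps)
    also have "\<dots> = e * s" using K by (simp add: e'_def)
    finally have "\<bar>G' z - s * hess F u w v\<bar> \<le> e * s" .
    then have "s * \<bar>G' z - s * hess F u w v\<bar> \<le> s * (e * s)" using s by (intro mult_left_mono) auto
    moreover have "s * \<bar>G' z - s * hess F u w v\<bar> = \<bar>G s - G 0 - s\<^sup>2 * hess F u w v\<bar>"
    proof -
      have "G s - G 0 - s\<^sup>2 * hess F u w v = s * (G' z - s * hess F u w v)"
        unfolding z(3) by (simp add: power2_eq_square algebra_simps)
      then show ?thesis using s(1) by (simp add: abs_mult)
    qed
    ultimately show ?thesis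
      by (simp add: G_def power2_eq_square algebra_simps)
  qed
  ultimately show ?thesis by (intro exI[of _ d]) auto
qed

lemma hess_symmetric_real:
  fixes F :: "'a::real_normed_vector \<Rightarrow> real"
  assumes F: "twice_diff_on U F" and u: "u \<in> U"
  shows "hess F u v w = hess F u w v"
proof (rule ccontr)
  assume ne: "hess F u v w \<noteq> hess F u w v"
  \<comment> \<open>A third of the gap: the second difference is symmetric in \<open>v\<close> and
    \<open>w\<close>, and two errors of \<open>e * s\<^sup>2\<close> cannot bridge a gap of
    \<open>3 * e * s\<^sup>2\<close>.\<close>
  define e where "e = \<bar>hess F u v w - hess F u w v\<bar> / 3"
  have e: "e > 0" using ne by (simp add: e_def)
  obtain d where d: "d > 0" "\<And>s. 0 < s \<and> s < d \<Longrightarrow>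
    \<bar>F (u + s *\<^sub>R v + s *\<^sub>R w) - F (u + s *\<^sub>R v) - F (u + s *\<^sub>R w) + F u - s\<^sup>2 * hess F u w v\<bar> \<le> e * s\<^sup>2"
    using second_difference_estimate[OF F u e, of v w] by blast
  obtain d' where d': "d' > 0" "\<And>s. 0 < s \<and> s < d' \<Longrightarrow>
    \<bar>F (u + s *\<^sub>R w + s *\<^sub>R v) - F (u + s *\<^sub>R w) - F (u + s *\<^sub>R v) + F u - s\<^sup>2 * hess F u v w\<bar> \<le> e * s\<^sup>2"
    using second_difference_estimate[OF F u e, of w v] by blast
  define s where "s = min d d' / 2"
  have s: "0 < s" "s < d" "s < d'" using d(1) d'(1) by (auto simp: s_def)
  have "F (u + s *\<^sub>R w + s *\<^sub>R v) = F (u + s *\<^sub>R v + s *\<^sub>R w)" by (simp add: algebra_simps)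
  then have "\<bar>s\<^sup>2 * hess F u v w - s\<^sup>2 * hess F u w v\<bar> \<le> 2 * (e * s\<^sup>2)"
    using d(2)[of s] d'(2)[of s] s by linarith
  moreover have "\<bar>s\<^sup>2 * hess F u v w - s\<^sup>2 * hess F u w v\<bar> = s\<^sup>2 * (3 * e)"
    by (simp add: e_def abs_mult flip: right_diff_distrib)
  ultimately show False using s e by (simp add: mult.commute)
qed

section \<open>Second derivatives of vector-valued maps and chain rules\<close>

lemma deriv_at_linear_compose:
  assumes "bounded_linear L" "F differentiable (at u)"
  shows "deriv_at (\<lambda>u. L (F u)) u = (\<lambda>v. L (deriv_at F u v))"
    "(\<lambda>u. L (F u)) differentiable (at u)"
proof -
  have *: "((\<lambda>u. L (F u)) has_derivative (\<lambda>v. L (deriv_at F u v))) (at u)"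
    using bounded_linear.has_derivative[OF assms(1)] assms(2)[unfolded frechet_derivative_works] by blast
  show "deriv_at (\<lambda>u. L (F u)) u = (\<lambda>v. L (deriv_at F u v))" by (rule deriv_at_eqI[OF *])
  show "(\<lambda>u. L (F u)) differentiable (at u)" using * differentiable_def by blast
qed

lemma twice_diff_on_linear_compose:
  assumes L: "bounded_linear L" and F: "twice_diff_on U F"
  shows "twice_diff_on U (\<lambda>u. L (F u))"
    "u \<in> U \<Longrightarrow> hess (\<lambda>u. L (F u)) u v w = L (hess F u v w)"
proof -
  have ev: "\<forall>\<^sub>F u' in nhds u. deriv_at (\<lambda>u. L (F u)) u' v = L (deriv_at F u' v)" if "u \<in> U" for u v
    using twice_diff_onD(1)[OF F] that
    by (rule eventually_nhds_openI) (simp add: deriv_at_linear_compose(1)[OF L twice_diff_onD(2)[OF F]])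
  show "twice_diff_on U (\<lambda>u. L (F u))"
    using F unfolding twice_diff_on_def
    by (auto simp: deriv_at_cong_ev(2)[OF ev] intro!: deriv_at_linear_compose(2)[OF L])
  show "hess (\<lambda>u. L (F u)) u v w = L (hess F u v w)" if "u \<in> U"
    unfolding deriv_at_cong_ev(1)[OF ev[OF that]]
    using deriv_at_linear_compose(1)[OF L twice_diff_onD(5)[OF F that]] by simp
qed

lemma hess_symmetric:
  fixes F :: "'a::real_normed_vector \<Rightarrow> 'b::euclidean_space"
  assumes F: "twice_diff_on U F" and u: "u \<in> U"
  shows "hess F u v w = hess F u w v"
proof (rule euclidean_eqI)
  fix b :: 'b
  have L: "bounded_linear (\<lambda>x. x \<bullet> b)" by (rule bounded_linear_inner_left)
  show "hess F u v w \<bullet> b = hess F u w v \<bullet> b"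
    using hess_symmetric_real[OF twice_diff_on_linear_compose(1)[OF L F] u, of v w]
    by (simp add: twice_diff_on_linear_compose(2)[OF L F u])
qed

lemma deriv_at_expand:
  fixes F :: "'a::euclidean_space \<Rightarrow> 'b::real_normed_vector"
  assumes "F differentiable (at u)"
  shows "deriv_at F u v = (\<Sum>i\<in>Basis. (v \<bullet> i) *\<^sub>R deriv_at F u i)"
proof -
  have lin: "linear (deriv_at F u)" by (rule linear_frechet_derivative[OF assms])
  have "deriv_at F u (\<Sum>i\<in>Basis. (v \<bullet> i) *\<^sub>R i) = (\<Sum>i\<in>Basis. (v \<bullet> i) *\<^sub>R deriv_at F u i)"
    by (simp add: linear_sum[OF lin] linear_scale[OF lin])
  then show ?thesis by (simp add: euclidean_representation)
qed

lemma hess_expand: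
  fixes F :: "'a::euclidean_space \<Rightarrow> 'b::real_normed_vector"
  assumes F: "twice_diff_on U F" and u: "u \<in> U"
  shows "hess F u v w = (\<Sum>i\<in>Basis. (w \<bullet> i) *\<^sub>R hess F u v i)"
proof -
  have "((\<lambda>u'. \<Sum>i\<in>Basis. (w \<bullet> i) *\<^sub>R deriv_at F u' i) has_derivative
      (\<lambda>v. \<Sum>i\<in>Basis. (w \<bullet> i) *\<^sub>R hess F u v i)) (at u)"
    by (auto intro!: derivative_eq_intros twice_diff_onD(6)[OF F u])
  moreover have "\<forall>\<^sub>F u' in nhds u. deriv_at F u' w = (\<Sum>i\<in>Basis. (w \<bullet> i) *\<^sub>R deriv_at F u' i)"
    using twice_diff_onD(1)[OF F] u
    by (rule eventually_nhds_openI) (rule deriv_at_expand[OF twice_diff_onD(2)[OF F]])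
  ultimately show ?thesis by (simp add: deriv_at_cong_ev(1) deriv_at_eqI)
qed

text \<open>Linearity in \<open>v\<close> is that of a derivative. Linearity in \<open>w\<close> is
  inherited from the first derivatives at nearby points, by expanding \<open>w\<close> in the basis
  before differentiating.\<close>

lemma bilinear_hess:
  fixes F :: "'a::euclidean_space \<Rightarrow> 'b::real_normed_vector"
  assumes F: "twice_diff_on U F" and u: "u \<in> U"
  shows "bilinear (hess F u)"
proof -
  have 1: "linear (\<lambda>v. hess F u v w)" for w
    by (rule linear_frechet_derivative[OF twice_diff_onD(5)[OF F u]])
  have 2: "linear (hess F u v)" for v
  proof -
    have "linear (\<lambda>w. \<Sum>i\<in>Basis. (w \<bullet> i) *\<^sub>R hess F u v i)"
      by (rule linearI) (simp_all add: inner_add_left scaleR_add_left sum.distrib scaleR_sum_right)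
    moreover have "hess F u v = (\<lambda>w. \<Sum>i\<in>Basis. (w \<bullet> i) *\<^sub>R hess F u v i)"
      by (rule ext) (rule hess_expand[OF F u])
    ultimately show ?thesis by metis
  qed
  show ?thesis using 1 2 by (simp add: bilinear_def)
qed

text \<open>Covers both the Hessian of a composition and derivatives of \<open>u \<mapsto> dF(S u)\<close> for a field \<open>S\<close>.\<close>

lemma has_derivative_deriv_at_compose:
  fixes F :: "'a::euclidean_space \<Rightarrow> 'b::real_normed_vector"
  assumes F: "twice_diff_on V F" and v: "\<theta> u \<in> V"
    and \<theta>: "(\<theta> has_derivative \<theta>') (at u)" and S: "(S has_derivative S') (at u)"
  shows "((\<lambda>u'. deriv_at F (\<theta> u') (S u')) has_derivative
    (\<lambda>w. hess F (\<theta> u) (\<theta>' w) (S u) + deriv_at F (\<theta> u) (S' w))) (at u)"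
proof -
  have c: "continuous (at u) \<theta>" using \<theta> has_derivative_continuous by blast
  then have "\<forall>\<^sub>F u' in nhds u. \<theta> u' \<in> V"
    using twice_diff_onD(1)[OF F] v
    by (metis continuous_at tendsto_at_iff_tendsto_nhds topological_tendstoD)
  \<comment> \<open>The basis expansion separates the two ways in which the expression depends on
    \<open>u'\<close>, so that the product rule applies to each summand.\<close>
  then have ev: "\<forall>\<^sub>F u' in nhds u.
      (\<Sum>i\<in>Basis. (S u' \<bullet> i) *\<^sub>R deriv_at F (\<theta> u') i) = deriv_at F (\<theta> u') (S u')"
    by eventually_elim (rule deriv_at_expand[OF twice_diff_onD(2)[OF F], symmetric])
  have d: "((\<lambda>u'. deriv_at F (\<theta> u') i) has_derivative (\<lambda>w. hess F (\<theta> u) (\<theta>' w) i)) (at u)" for i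
    using has_derivative_compose[OF \<theta> twice_diff_onD(6)[OF F v]] .
  have "((\<lambda>u'. \<Sum>i\<in>Basis. (S u' \<bullet> i) *\<^sub>R deriv_at F (\<theta> u') i) has_derivative
     (\<lambda>w. \<Sum>i\<in>Basis. (S u \<bullet> i) *\<^sub>R hess F (\<theta> u) (\<theta>' w) i + (S' w \<bullet> i) *\<^sub>R deriv_at F (\<theta> u) i)) (at u)"
    by (intro has_derivative_sum has_derivative_scaleR d has_derivative_inner_left S)
  moreover have "(\<lambda>w. \<Sum>i\<in>Basis. (S u \<bullet> i) *\<^sub>R hess F (\<theta> u) (\<theta>' w) i + (S' w \<bullet> i) *\<^sub>R deriv_at F (\<theta> u) i)
     = (\<lambda>w. hess F (\<theta> u) (\<theta>' w) (S u) + deriv_at F (\<theta> u) (S' w))"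
  proof
    fix w
    show "(\<Sum>i\<in>Basis. (S u \<bullet> i) *\<^sub>R hess F (\<theta> u) (\<theta>' w) i + (S' w \<bullet> i) *\<^sub>R deriv_at F (\<theta> u) i)
      = hess F (\<theta> u) (\<theta>' w) (S u) + deriv_at F (\<theta> u) (S' w)"
      by (subst hess_expand[OF F v], subst deriv_at_expand[OF twice_diff_onD(2)[OF F v], of "S' w"])
        (rule sum.distrib)
  qed
  ultimately have "((\<lambda>u'. \<Sum>i\<in>Basis. (S u' \<bullet> i) *\<^sub>R deriv_at F (\<theta> u') i) has_derivative
     (\<lambda>w. hess F (\<theta> u) (\<theta>' w) (S u) + deriv_at F (\<theta> u) (S' w))) (at u)"
    by simp
  then show ?thesis
    by (rule has_derivative_transform_eventually) (use ev in \<open>auto simp: eventually_nhds_conv_at\<close>)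
qed

section \<open>Differentiable solutions of linear systems\<close>

lemma differentiable_prod_at:
  fixes f :: "'i \<Rightarrow> 'a::real_normed_vector \<Rightarrow> real"
  assumes "finite I" "\<And>i. i \<in> I \<Longrightarrow> f i differentiable (at u)"
  shows "(\<lambda>x. \<Prod>i\<in>I. f i x) differentiable (at u)"
  using assms
  by (induction I rule: finite_induct) (simp_all add: differentiable_mult)

lemma differentiable_det:
  fixes A :: "'a::real_normed_vector \<Rightarrow> real^'n^'n"
  assumes "\<And>i j. (\<lambda>u. A u $ i $ j) differentiable (at u)"
  shows "(\<lambda>u. det (A u)) differentiable (at u)"
proof -
  have "(\<lambda>u. \<Prod>i\<in>UNIV. A u $ i $ p i) differentiable (at u)" for p
    by (rule differentiable_prod_at) (use assms in auto)
  then show ?thesis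
    unfolding det_def
    by (intro differentiable_sum ballI finite_permutations finite) (simp add: differentiable_mult)
qed

text \<open>By Cramer's rule the solution agrees near \<open>u\<close> with quotients of
  determinants of differentiable entries; nothing beyond the equation has to be known about
  \<open>x\<close>.\<close>

lemma differentiable_linear_solve:
  fixes A :: "'a::real_normed_vector \<Rightarrow> real^'n^'n" and x y :: "'a \<Rightarrow> real^'n"
  assumes A: "\<And>i j. (\<lambda>u. A u $ i $ j) differentiable (at u)"
    and y: "\<And>i. (\<lambda>u. y u $ i) differentiable (at u)"
    and U: "open U" "u \<in> U"
    and det: "\<And>v. v \<in> U \<Longrightarrow> det (A v) \<noteq> 0" and eq: "\<And>v. v \<in> U \<Longrightarrow> A v *v x v = y v"
  shows "x differentiable (at u)"
proof -
  define X where "X = (\<lambda>v. \<chi> k. det (\<chi> i j. if j = k then y v $ i else A v $ i $ j) / det (A v))"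
  have comp: "(\<lambda>v. X v $ k) differentiable (at u)" for k
    unfolding X_def vec_lambda_beta
  proof (intro differentiable_divide differentiable_det)
    show "(\<lambda>u. (\<chi> i j. if j = k then y u $ i else A u $ i $ j) $ i $ j) differentiable (at u)" for i j
      using A y by (cases "j = k") simp_all
  qed (use A det U in auto)
  have "(\<lambda>v. X v \<bullet> i) differentiable (at u)" if i: "i \<in> Basis" for i
  proof -
    obtain k where "i = axis k 1" using i by (auto simp: Basis_vec_def)
    then show ?thesis using comp[of k] by (simp add: inner_axis)
  qed
  then have "X differentiable (at u)"
    using differentiable_componentwise_within[of X u UNIV] by blast
  moreover have "\<forall>\<^sub>F v in nhds u. x v = X v"
    using U by (rule eventually_nhds_openI) (use cramer[OF det] eq in \<open>simp add: X_def\<close>)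
  ultimately show ?thesis by (simp add: deriv_at_cong_ev(2))
qed


section \<open>Parametrized immersions\<close>

text \<open>Definiteness is asked of tangent spaces only, since the ambient form is allowed to be
  Lorentzian.\<close>

locale riemannian_target =
  fixes g :: "'e::euclidean_space \<Rightarrow> 'e \<Rightarrow> real" and N :: "'e set"
  assumes form: "symmetric_form g"
    and tangent_subspace: "y \<in> N \<Longrightarrow> subspace (tangent_space N y)"
    and tangent_pos_def: "y \<in> N \<Longrightarrow> pos_def_on (tangent_space N y) g"

locale param_immersion = riemannian_target g N
  for g :: "'e::euclidean_space \<Rightarrow> 'e \<Rightarrow> real" and N +
  fixes U :: "'m::euclidean_space set" and F :: "'m \<Rightarrow> 'e"
  assumes twice_diff: "twice_diff_on U F"
    and into: "u \<in> U \<Longrightarrow> F u \<in> N"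
    and inj_deriv: "u \<in> U \<Longrightarrow> inj (deriv_at F u)"
begin

lemmas g_simps = symmetric_form_simps[OF form]
lemmas g_commute = symmetric_formD(2)[OF form]
lemmas linear_deriv = twice_diff_onD(3)[OF twice_diff]

lemma deriv_tangent:
  assumes u: "u \<in> U"
  shows "deriv_at F u v \<in> tangent_space N (F u)"
proof -
  let ?\<gamma> = "\<lambda>t::real. F (u + t *\<^sub>R v)"
  have line: "((\<lambda>t. u + t *\<^sub>R v) has_derivative (\<lambda>t. t *\<^sub>R v)) (at 0)"
    by (auto intro!: derivative_eq_intros)
  have "((\<lambda>t. u + t *\<^sub>R v) \<longlongrightarrow> u) (nhds (0::real))"
    by (auto intro!: tendsto_eq_intros filterlim_ident)
  then have "\<forall>\<^sub>F t in nhds (0::real). u + t *\<^sub>R v \<in> U"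
    using twice_diff_onD(1)[OF twice_diff] u by (metis topological_tendstoD)
  then have "\<forall>\<^sub>F t in nhds 0. ?\<gamma> t \<in> N"
    by eventually_elim (rule into)
  moreover have "(F has_derivative deriv_at F u) (at (u + 0 *\<^sub>R v))"
    using twice_diff_onD(4)[OF twice_diff u] by simp
  from has_derivative_compose[OF line this]
  have "(?\<gamma> has_vector_derivative deriv_at F u v) (at 0)"
    by (simp add: has_vector_derivative_def linear_scale[OF linear_deriv[OF u]])
  ultimately have "velocity_curve N (F u) (deriv_at F u v) ?\<gamma>"
    by (simp add: velocity_curve_def)
  then show ?thesis unfolding tangent_space_def by blast
qed

lemma induced_form:
  assumes u: "u \<in> U"
  shows "symmetric_form (induced_metric g F u)" "pos_def_on UNIV (induced_metric g F u)"
proof -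
  note l = linear_add[OF linear_deriv[OF u]] linear_scale[OF linear_deriv[OF u]]
  show "symmetric_form (induced_metric g F u)"
    unfolding symmetric_form_def bilinear_def induced_metric_def
    using g_commute by (auto intro!: linearI simp: l g_simps)
  show "pos_def_on UNIV (induced_metric g F u)"
    unfolding pos_def_on_def induced_metric_def
  proof (intro ballI impI)
    fix v :: 'm assume "v \<noteq> 0"
    then have "deriv_at F u v \<noteq> 0"
      using inj_deriv[OF u] linear_0[OF linear_deriv[OF u]] by (metis injD)
    then show "g (deriv_at F u v) (deriv_at F u v) > 0"
      using tangent_pos_def[OF into[OF u]] deriv_tangent[OF u] by (simp add: pos_def_on_def)
  qed
qed

lemma normal_spaceD:
  "\<xi> \<in> normal_space g N F u \<Longrightarrow> \<xi> \<in> tangent_space N (F u)"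
  "\<xi> \<in> normal_space g N F u \<Longrightarrow> g \<xi> (deriv_at F u v) = 0"
  "\<xi> \<in> normal_space g N F u \<Longrightarrow> g (deriv_at F u v) \<xi> = 0"
  unfolding normal_space_def using g_commute by auto

lemma normal_space:
  assumes u: "u \<in> U"
  shows "subspace (normal_space g N F u)" "pos_def_on (normal_space g N F u) g"
proof -
  show "subspace (normal_space g N F u)"
    using tangent_subspace[OF into[OF u]] unfolding normal_space_def subspace_def
    by (auto simp: g_simps)
  show "pos_def_on (normal_space g N F u) g"
    by (rule pos_def_on_mono[OF tangent_pos_def[OF into[OF u]]]) (auto simp: normal_space_def)
qed

lemmas normal_proj = orth_proj_props[OF form normal_space]
lemmas tangent_proj = orth_proj_props[OF form tangent_subspace[OF into] tangent_pos_def[OF into]]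

text \<open>Pairing with a vector that lies in the images of both projections makes them disappear.
  From here on normal components are computed from flat second derivatives.\<close>

lemma normal_component_second_ff:
  assumes "u \<in> U" "\<xi> \<in> normal_space g N F u"
  shows "g (second_ff g N F u v w) \<xi> = g (hess F u v w) \<xi>"
  unfolding second_ff_def pullback_conn_def
  using assms normal_proj(2) tangent_proj(2) normal_spaceD(1) by simp

lemma normal_component_normal_conn:
  assumes "u \<in> U" "\<xi> \<in> normal_space g N F u"
  shows "g (normal_conn g N F V u v) \<xi> = g (deriv_at V u v) \<xi>"
  unfolding normal_conn_def pullback_conn_def
  using assms normal_proj(2) tangent_proj(2) normal_spaceD(1) by simp

lemma mean_curv_normal:
  assumes u: "u \<in> U"
  shows "mean_curv g N F u \<in> normal_space g N F u"
proof -
  have "second_ff g N F u v w \<in> normal_space g N F u" for v w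
    unfolding second_ff_def by (rule normal_proj(1)[OF u u])
  then show ?thesis
    unfolding mean_curv_def metric_trace_def Let_def
    by (intro subspace_scale subspace_sum normal_space(1)[OF u])
qed

lemma normal_component_mean_curv:
  assumes "u \<in> U" "\<xi> \<in> normal_space g N F u"
  shows "real DIM('m) * g (mean_curv g N F u) \<xi>
    = metric_trace (induced_metric g F u) (\<lambda>v w. g (hess F u v w) \<xi>)"
proof -
  have "metric_trace (induced_metric g F u) (\<lambda>v w. g (hess F u v w) \<xi>)
    = g (metric_trace (induced_metric g F u) (second_ff g N F u)) \<xi>"
    unfolding normal_component_second_ff[OF assms, symmetric]
    by (rule metric_trace_linear(1)[OF symmetric_formD(4)[OF form]])
  then show ?thesis by (simp add: mean_curv_def g_simps)
qed

lemma tangent_part_eqI: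
  assumes u: "u \<in> U" and v: "d - deriv_at F u v \<in> normal_space g N F u"
  shows "tangent_part g N d F u = v"
  unfolding tangent_part_def
proof (rule the_equality[of _ v])
  fix v' assume v': "d - deriv_at F u v' \<in> normal_space g N F u"
  have "induced_metric g F u (v' - v) (v' - v) =
     g (d - deriv_at F u v) (deriv_at F u (v' - v)) - g (d - deriv_at F u v') (deriv_at F u (v' - v))"
    unfolding induced_metric_def linear_diff[OF linear_deriv[OF u]] by (simp add: g_simps)
  also have "\<dots> = 0" using normal_spaceD(2)[OF v] normal_spaceD(2)[OF v'] by simp
  finally show "v' = v" using pos_def_onD[OF induced_form(2)[OF u]] by fastforce
qed (fact v)

text \<open>The projection of \<open>d\<close> onto the image of the differential supplies the
  witness for the \<open>THE\<close> in \<open>tangent_part\<close>.\<close>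

lemma tangent_part_normal:
  assumes u: "u \<in> U" and d: "d \<in> tangent_space N (F u)"
  shows "d - deriv_at F u (tangent_part g N d F u) \<in> normal_space g N F u"
proof -
  let ?R = "range (deriv_at F u)"
  have R: "subspace ?R"
    using linear_subspace_image[OF linear_deriv[OF u] subspace_UNIV] .
  have pd: "pos_def_on ?R g"
    by (rule pos_def_on_mono[OF tangent_pos_def[OF into[OF u]]]) (use deriv_tangent[OF u] in auto)
  obtain v where v: "orth_proj g ?R d = deriv_at F u v"
    using orth_proj_props(1)[OF form R pd, of d] by auto
  have "g (d - deriv_at F u v) (deriv_at F u w) = 0" for w
    using orth_proj_props(2)[OF form R pd, of "deriv_at F u w" d] by (simp add: v g_simps)
  then have *: "d - deriv_at F u v \<in> normal_space g N F u"
    unfolding normal_space_def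
    using subspace_diff[OF tangent_subspace[OF into[OF u]] d deriv_tangent[OF u]] by simp
  show ?thesis unfolding tangent_part_eqI[OF u *] by (rule *)
qed

text \<open>For the vertical unit vector this says that \<open>T\<close> is the gradient of the
  height function.\<close>

lemma induced_metric_tangent_part:
  assumes "u \<in> U" "d \<in> tangent_space N (F u)"
  shows "induced_metric g F u (tangent_part g N d F u) v = g d (deriv_at F u v)"
  using normal_spaceD(2)[OF tangent_part_normal[OF assms], of v]
  by (simp add: induced_metric_def g_simps)

text \<open>Differentiating \<open>F\<^sub>*T = d\<close> shows that the second derivatives \<open>F\<^bsub>wT\<^esub>\<close> are tangent.\<close>

lemma shape_op_tangent_part:
  assumes u: "u \<in> U" and \<xi>: "\<xi> \<in> normal_space g N F u"
    and T: "T differentiable (at u)" and W: "open W" "u \<in> W"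
    and eq: "\<And>u'. u' \<in> W \<Longrightarrow> deriv_at F u' (T u') = d"
  shows "shape_op g N F u \<xi> (T u) = 0"
proof -
  have "g (second_ff g N F u (T u) w) \<xi> = 0" for w
  proof -
    have "((\<lambda>u'. deriv_at F u' (T u')) has_derivative
       (\<lambda>w. hess F u w (T u) + deriv_at F u (deriv_at T u w))) (at u)"
      using has_derivative_deriv_at_compose[OF twice_diff, of "\<lambda>x. x" u, OF u has_derivative_ident
          T[unfolded frechet_derivative_works]] .
    then have "deriv_at (\<lambda>u'. deriv_at F u' (T u')) u w = hess F u w (T u) + deriv_at F u (deriv_at T u w)"
      by (simp add: deriv_at_eqI)
    moreover have "\<forall>\<^sub>F u' in nhds u. deriv_at F u' (T u') = d"
      using W eq by (rule eventually_nhds_openI)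
    from deriv_at_cong_ev(1)[OF this] have "deriv_at (\<lambda>u'. deriv_at F u' (T u')) u w = 0" by simp
    \<comment> \<open>Differentiating the field leaves \<open>T u\<close> in the second slot;
      symmetry moves it to the first, where \<open>shape_op\<close> takes its argument.\<close>
    ultimately have "hess F u (T u) w = - deriv_at F u (deriv_at T u w)"
      using hess_symmetric[OF twice_diff u, of w "T u"] by (simp add: eq_neg_iff_add_eq_0)
    then show ?thesis
      using normal_component_second_ff[OF u \<xi>] normal_spaceD(3)[OF \<xi>] by (simp add: g_simps)
  qed
  then have "shape_op g N F u \<xi> (T u) = (THE a. \<forall>w. induced_metric g F u a w = 0)"
    by (simp add: shape_op_def)
  also have "\<dots> = 0"
    using pos_def_onD[OF induced_form(2)[OF u]] symmetric_form_simps(4)[OF induced_form(1)[OF u]]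
    by (intro the_equality) auto
  finally show ?thesis .
qed

end

section \<open>Regularity of the tangent part of a constant vector\<close>

lemma form_differentiable:
  fixes g :: "'e::euclidean_space \<Rightarrow> 'e \<Rightarrow> real"
  assumes "symmetric_form g" "a differentiable (at u)" "b differentiable (at u)"
  shows "(\<lambda>u. g (a u) (b u)) differentiable (at u)"
proof -
  have "bounded_bilinear g"
    using symmetric_formD(1)[OF assms(1)] bilinear_conv_bounded_bilinear by blast
  from bounded_bilinear.FDERIV[OF this assms(2,3)[unfolded frechet_derivative_works]]
  show ?thesis unfolding differentiable_def by blast
qed

text \<open>\<open>tangent_part\<close> is a pointwise description, so its regularity is read off
  the system it solves: the Gram matrix \<open>A\<close> of the coordinate fields applied to it
  gives their products \<open>y\<close> with \<open>d\<close>. A kernel vector of \<open>A\<close>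
  would be orthogonal to itself, so \<open>A\<close> is invertible.\<close>

lemma tangent_part_differentiable:
  fixes F :: "real^'m \<Rightarrow> 'e::euclidean_space"
  assumes "param_immersion g N U F" and u: "u \<in> U"
    and d: "\<And>u. u \<in> U \<Longrightarrow> d \<in> tangent_space N (F u)"
  shows "(\<lambda>u. tangent_part g N d F u) differentiable (at u)"
proof -
  interpret param_immersion g N U F by fact
  define A where "A = (\<lambda>u. \<chi> i j. induced_metric g F u (axis i (1::real)) (axis j 1))"
  define y where "y = (\<lambda>u. \<chi> i. g (deriv_at F u (axis i (1::real))) d)"
  have mult: "A u *v x = (\<chi> i. induced_metric g F u (axis i 1) x)" if "u \<in> U" for u x
  proof -
    note s = symmetric_form_simps[OF induced_form(1)[OF that]]
    have "induced_metric g F u a x = (\<Sum>j\<in>UNIV. induced_metric g F u a (axis j 1) * x $ j)" for a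
    proof -
      have "induced_metric g F u a (\<Sum>j\<in>UNIV. (x $ j) *\<^sub>R axis j 1)
          = (\<Sum>j\<in>UNIV. induced_metric g F u a (axis j 1) * x $ j)"
        by (simp add: s mult.commute)
      moreover have "(\<Sum>j\<in>UNIV. (x $ j) *\<^sub>R axis j 1) = x"
        using basis_expansion[of x] by (simp add: scalar_mult_eq_scaleR)
      ultimately show ?thesis by simp
    qed
    then show ?thesis by (simp add: A_def matrix_vector_mult_def vec_eq_iff)
  qed
  show ?thesis
  proof (rule differentiable_linear_solve[of A u y U])
    show "(\<lambda>u. A u $ i $ j) differentiable (at u)" "(\<lambda>u. y u $ i) differentiable (at u)" for i j
      unfolding A_def y_def vec_lambda_beta induced_metric_def
      by (intro form_differentiable[OF form] twice_diff_onD(5)[OF twice_diff u] differentiable_const)+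
    show "open U" "u \<in> U" using twice_diff_onD(1)[OF twice_diff] u by auto
    fix v assume v: "v \<in> U"
    show "A v *v tangent_part g N d F v = y v"
      using induced_metric_tangent_part[OF v d[OF v]] symmetric_formD(2)[OF induced_form(1)[OF v]]
      by (simp add: mult[OF v] y_def g_commute vec_eq_iff)
    have ker: "x = 0" if x: "A v *v x = 0" for x
    proof -
      have "induced_metric g F v (axis i 1) x = 0" for i
        using x unfolding mult[OF v] by (simp add: vec_eq_iff)
      then have "induced_metric g F v (\<Sum>j\<in>UNIV. (x $ j) *\<^sub>R axis j 1) x = 0"
        by (simp add: symmetric_form_simps[OF induced_form(1)[OF v]])
      moreover have "(\<Sum>j\<in>UNIV. (x $ j) *\<^sub>R axis j 1) = x"
        using basis_expansion[of x] by (simp add: scalar_mult_eq_scaleR)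
      ultimately show "x = 0" using pos_def_onD[OF induced_form(2)[OF v], of x] by simp
    qed
    have "invertible (A v)"
      unfolding invertible_left_inverse matrix_left_invertible_ker using ker by blast
    then show "det (A v) \<noteq> 0" by (simp add: invertible_det_nz)
  qed
qed


section \<open>The products of space forms with the line\<close>

text \<open>Serves both targets: \<open>Q\<close> ignores the line factor, \<open>K\<close> deletes
  it, and the open set \<open>D\<close> selects the sheet in the hyperbolic case. One inclusion
  differentiates the equation along a curve; for the other the straight line through
  \<open>y\<close> is rescaled back onto the quadric, with its component along the line factor left
  alone.\<close>

lemma tangent_space_quadric:
  fixes Q :: "'e::euclidean_space \<Rightarrow> 'e \<Rightarrow> real"
  assumes Q: "symmetric_form Q" and K: "\<And>v w. Q (K v) w = Q v w" "linear K"
    and c: "c \<noteq> 0" and D: "open D" and y: "Q y y = c" "y \<in> D"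
  shows "tangent_space {y \<in> D. Q y y = c} y = {v. Q y v = 0}"
proof (intro set_eqI iffI)
  note s = symmetric_form_simps[OF Q]
  have bb: "bounded_bilinear Q"
    using symmetric_formD(1)[OF Q] bilinear_conv_bounded_bilinear by blast
  fix v assume "v \<in> tangent_space {y \<in> D. Q y y = c} y"
  then obtain \<gamma> where "velocity_curve {y \<in> D. Q y y = c} y v \<gamma>"
    by (auto simp: tangent_space_def)
  then have \<gamma>: "\<gamma> 0 = y" "\<forall>\<^sub>F t in nhds 0. Q (\<gamma> t) (\<gamma> t) = c"
      "(\<gamma> has_vector_derivative v) (at 0)"
    by (auto simp: velocity_curve_def elim: eventually_mono)
  have "((\<lambda>t. Q (\<gamma> t) (\<gamma> t)) has_derivative (\<lambda>t. Q y (t *\<^sub>R v) + Q (t *\<^sub>R v) y)) (at 0)"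
    using bounded_bilinear.FDERIV[OF bb \<gamma>(3)[unfolded has_vector_derivative_def]
        \<gamma>(3)[unfolded has_vector_derivative_def]] \<gamma>(1) by simp
  then have "deriv_at (\<lambda>t. Q (\<gamma> t) (\<gamma> t)) 0 1 = 2 * Q y v"
    by (simp add: deriv_at_eqI symmetric_formD(2)[OF Q, of v y])
  moreover have "deriv_at (\<lambda>t. Q (\<gamma> t) (\<gamma> t)) 0 1 = 0"
    using deriv_at_cong_ev(1)[OF \<gamma>(2)] by simp
  ultimately show "v \<in> {v. Q y v = 0}" by simp
next
  note s = symmetric_form_simps[OF Q]
  fix v assume "v \<in> {v. Q y v = 0}"
  then have v: "Q y v = 0" "Q v y = 0" using symmetric_formD(2)[OF Q] by auto
  have K': "Q w (K v) = Q w v" for v w using K(1) symmetric_formD(2)[OF Q] by metis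
  define q where "q = Q v v / c"
  \<comment> \<open>Since \<open>Q y v = 0\<close>, the square of \<open>y + t *\<^sub>R v\<close>
    is \<open>c * (1 + t\<^sup>2 * q)\<close>, which \<open>\<mu>\<close> normalizes to
    \<open>c\<close>. The correction is of second order in \<open>t\<close>, so the velocity at 0
    stays \<open>v\<close>.\<close>
  define \<mu> where "\<mu> = (\<lambda>t::real. 1 / sqrt (1 + t\<^sup>2 * q))"
  define \<gamma> where "\<gamma> = (\<lambda>t. (y + t *\<^sub>R v) + (\<mu> t - 1) *\<^sub>R (K y + t *\<^sub>R K v))"
  have \<mu>: "\<mu> 0 = 1" "(\<mu> has_real_derivative 0) (at 0)"
    unfolding \<mu>_def by (auto intro!: derivative_eq_intros)
  then have \<mu>': "(\<mu> has_derivative (\<lambda>t. 0)) (at 0)"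
    by (simp add: has_field_derivative_def lambda_zero)
  have "(\<gamma> has_vector_derivative v) (at 0)"
    unfolding \<gamma>_def using \<mu>(1)
    by (auto intro!: derivative_eq_intros \<mu>' simp: has_vector_derivative_def)
  have tend: "((\<lambda>t. 1 + t\<^sup>2 * q) \<longlongrightarrow> 1) (nhds 0)"
    by (auto intro!: tendsto_eq_intros filterlim_ident)
  have "\<forall>\<^sub>F t in nhds 0. 1 + t\<^sup>2 * q > 0"
    using order_tendstoD(1)[OF tend] by simp
  then have 1: "\<forall>\<^sub>F t in nhds 0. Q (\<gamma> t) (\<gamma> t) = c"
  proof eventually_elim
    fix t assume t: "1 + t\<^sup>2 * q > 0"
    have Kl: "Q (K y + t *\<^sub>R K v) w = Q (y + t *\<^sub>R v) w" "Q w (K y + t *\<^sub>R K v) = Q w (y + t *\<^sub>R v)" for w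
      by (simp_all add: s K K')
    have "Q (\<gamma> t) (\<gamma> t) = (\<mu> t)\<^sup>2 * Q (y + t *\<^sub>R v) (y + t *\<^sub>R v)"
      unfolding \<gamma>_def
      by (simp only: s(1,7)[of "y + t *\<^sub>R v"] s(3,9) Kl) (simp add: power2_eq_square algebra_simps)
    also have "Q (y + t *\<^sub>R v) (y + t *\<^sub>R v) = c * (1 + t\<^sup>2 * q)"
      using c v y by (simp add: s q_def power2_eq_square algebra_simps)
    also have "(\<mu> t)\<^sup>2 * (c * (1 + t\<^sup>2 * q)) = c"
      using t by (simp add: \<mu>_def power_divide)
    finally show "Q (\<gamma> t) (\<gamma> t) = c" .
  qed
  have "continuous (at 0) \<gamma>"
    using \<open>(\<gamma> has_vector_derivative v) (at 0)\<close> has_vector_derivative_continuous by blast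
  moreover have "\<gamma> 0 = y" by (simp add: \<gamma>_def \<mu>(1))
  ultimately have 2: "\<forall>\<^sub>F t in nhds 0. \<gamma> t \<in> D"
    using D y(2) by (metis continuous_at tendsto_at_iff_tendsto_nhds topological_tendstoD)
  have "velocity_curve {y \<in> D. Q y y = c} y v \<gamma>"
    unfolding velocity_curve_def using \<open>\<gamma> 0 = y\<close> \<open>(\<gamma> has_vector_derivative v) (at 0)\<close>
      eventually_conj[OF 1 2] by (auto elim: eventually_mono)
  then show "v \<in> tangent_space {y \<in> D. Q y y = c} y" by (auto simp: tangent_space_def)
qed

text \<open>A vector orthogonal to a timelike vector is spacelike.\<close>

lemma lorentz_orthogonal_pos:
  fixes p p' :: "'a::real_inner" and r r' k :: real
  assumes "p \<bullet> p = r\<^sup>2 - k" "k > 0" "p \<bullet> p' = r * r'" "p' \<noteq> 0 \<or> r' \<noteq> 0"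
  shows "p' \<bullet> p' - r'\<^sup>2 > 0"
proof -
  have "(r * r')\<^sup>2 \<le> (r\<^sup>2 - k) * (p' \<bullet> p')"
    using Cauchy_Schwarz_ineq[of p p'] assms(1,3) by simp
  then have *: "k * (p' \<bullet> p') \<le> r\<^sup>2 * (p' \<bullet> p' - r'\<^sup>2)"
    by (simp add: power_mult_distrib algebra_simps)
  have r: "r\<^sup>2 > 0" using assms(1,2) inner_ge_zero[of p] by linarith
  show ?thesis
  proof (cases "p' = 0")
    case True
    then have "r * r' = 0" "r' \<noteq> 0" using assms by auto
    then show ?thesis using r by simp
  next
    case False
    then have "0 < k * (p' \<bullet> p')" using assms(2) by simp
    then have "0 < r\<^sup>2 * (p' \<bullet> p' - r'\<^sup>2)" using * by linarith
    then show ?thesis using r by (simp add: zero_less_mult_iff)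
  qed
qed

section \<open>The forms, their quadrics and the two targets\<close>

lemma E3_form: "symmetric_form (E3_form \<epsilon>)"
  unfolding symmetric_form_def bilinear_def E3_form_def
  by (auto intro!: linearI simp: algebra_simps)

lemmas E3_simps = symmetric_form_simps[OF E3_form]

lemma E4_form: "symmetric_form (E4_form \<epsilon>)"
  unfolding symmetric_form_def bilinear_def E4_form_def
  by (auto intro!: linearI simp: E3_simps algebra_simps symmetric_formD(2)[OF E3_form])

lemma E6_form: "symmetric_form (E6_form \<epsilon>)"
  unfolding symmetric_form_def bilinear_def E6_form_def
  by (auto intro!: linearI simp: E3_simps inner_simps algebra_simps inner_commute
      symmetric_formD(2)[OF E3_form])

lemma E_form_Pair:
  "E4_form \<epsilon> (x, t) (x', t') = E3_form \<epsilon> x x' + t * t'"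
  "E6_form \<epsilon> (z, y) (z', y') = z \<bullet> z' + E4_form \<epsilon> y y'"
  by (auto simp: E4_form_def E6_form_def split: prod.splits)

lemma E3_form_pos:
  assumes "\<epsilon> = 1" "x \<noteq> 0"
  shows "E3_form \<epsilon> x x > 0"
proof -
  have "E3_form \<epsilon> x x = x \<bullet> x" using assms(1) by (simp add: E3_form_def inner_vec_def sum_3)
  then show ?thesis using assms(2) by simp
qed

lemma E3_form_Lorentz: "E3_form (-1) x y = (x $ 2, x $ 3) \<bullet> (y $ 2, y $ 3) - x $ 1 * y $ 1"
  by (simp add: E3_form_def)

lemma E3_eq_0: "(x :: real^3) = 0 \<longleftrightarrow> (x $ 2, x $ 3) = 0 \<and> x $ 1 = 0"
  by (auto simp: vec_eq_iff forall_3 zero_prod_def)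

text \<open>This is \<open>E6_form\<close> without the line term, hence degenerate;
  \<open>Q4_R\<close> is its level set at \<open>\<epsilon>\<close>, restricted to one sheet when
  \<open>\<epsilon> = -1\<close>.\<close>

definition horizontal_form :: "real \<Rightarrow> (real^2) \<times> (real^3) \<times> real \<Rightarrow> (real^2) \<times> (real^3) \<times> real \<Rightarrow> real" where
  "horizontal_form \<epsilon> y w = fst y \<bullet> fst w + E3_form \<epsilon> (fst (snd y)) (fst (snd w))"

lemma circle_pt_inner: "circle_pt b s \<bullet> circle_pt b s = b\<^sup>2"
proof -
  have "circle_pt b s \<bullet> circle_pt b s = (b * cos (s / b))\<^sup>2 + (b * sin (s / b))\<^sup>2"
    by (simp add: circle_pt_def inner_vec_def sum_2 power2_eq_square)
  also have "\<dots> = b\<^sup>2 * ((cos (s / b))\<^sup>2 + (sin (s / b))\<^sup>2)" by algebra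
  finally show ?thesis by simp
qed

lemma Q2_R_eq: "Q2_R \<epsilon> b = {y \<in> {y. \<epsilon> = -1 \<longrightarrow> fst y $ 1 > 0}. E3_form \<epsilon> (fst y) (fst y) = \<epsilon> - b\<^sup>2}"
  by (auto simp: Q2_R_def Q2_def Q4_def circle_pt_inner)

lemma Q4_R_eq: "Q4_R \<epsilon> = {y \<in> {y. \<epsilon> = -1 \<longrightarrow> fst (snd y) $ 1 > 0}. horizontal_form \<epsilon> y y = \<epsilon>}"
  by (auto simp: Q4_R_def Q4_def horizontal_form_def)

lemma tangent_space_Q2_R:
  assumes "\<epsilon> \<noteq> b\<^sup>2" "y \<in> Q2_R \<epsilon> b"
  shows "tangent_space (Q2_R \<epsilon> b) y = {v. E3_form \<epsilon> (fst y) (fst v) = 0}"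
  unfolding Q2_R_eq
proof (rule tangent_space_quadric[of "\<lambda>y w. E3_form \<epsilon> (fst y) (fst w)" "\<lambda>y. (fst y, 0)"])
  show "symmetric_form (\<lambda>y w :: (real^3) \<times> real. E3_form \<epsilon> (fst y) (fst w))"
    unfolding symmetric_form_def bilinear_def
    by (auto intro!: linearI simp: E3_simps symmetric_formD(2)[OF E3_form])
  show "open {y :: (real^3) \<times> real. \<epsilon> = -1 \<longrightarrow> fst y $ 1 > 0}"
    by (cases "\<epsilon> = -1") (auto intro!: open_Collect_less continuous_intros)
qed (use assms in \<open>auto simp: Q2_R_eq intro!: linearI\<close>)

lemma tangent_space_Q4_R:
  assumes "\<epsilon> \<noteq> 0" "y \<in> Q4_R \<epsilon>"
  shows "tangent_space (Q4_R \<epsilon>) y = {v. horizontal_form \<epsilon> y v = 0}"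
  unfolding Q4_R_eq
proof (rule tangent_space_quadric[of "horizontal_form \<epsilon>" "\<lambda>y. (fst y, fst (snd y), 0)"])
  show "symmetric_form (horizontal_form \<epsilon>)"
    unfolding symmetric_form_def bilinear_def horizontal_form_def
    by (auto intro!: linearI simp: E3_simps inner_simps inner_commute algebra_simps
        symmetric_formD(2)[OF E3_form])
  show "open {y :: (real^2) \<times> (real^3) \<times> real. \<epsilon> = -1 \<longrightarrow> fst (snd y) $ 1 > 0}"
    by (cases "\<epsilon> = -1") (auto intro!: open_Collect_less continuous_intros)
qed (use assms in \<open>auto simp: Q4_R_eq horizontal_form_def intro!: linearI\<close>)

text \<open>For \<open>\<epsilon> = -1\<close> the position vector has square
  \<open>-(1 + b\<^sup>2)\<close>, so it is timelike and vectors orthogonal to it are spacelike. The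
  line factor only adds a square. \<open>\<epsilon> \<noteq> b\<^sup>2\<close> makes the level of
  the quadric nonzero.\<close>

lemma riemannian_Q2_R:
  assumes "\<epsilon> \<in> {1, -1}" "\<epsilon> \<noteq> b\<^sup>2"
  shows "riemannian_target (E4_form \<epsilon>) (Q2_R \<epsilon> b)"
proof
  fix y assume y: "y \<in> Q2_R \<epsilon> b"
  show "subspace (tangent_space (Q2_R \<epsilon> b) y)"
    unfolding tangent_space_Q2_R[OF assms(2) y] by (auto intro!: subspaceI simp: E3_simps)
  show "pos_def_on (tangent_space (Q2_R \<epsilon> b) y) (E4_form \<epsilon>)"
    unfolding tangent_space_Q2_R[OF assms(2) y] pos_def_on_def
  proof (intro ballI impI)
    fix v :: "(real^3) \<times> real" assume v: "v \<in> {v. E3_form \<epsilon> (fst y) (fst v) = 0}" "v \<noteq> 0"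
    obtain x t where xt: "v = (x, t)" by (cases v)
    have "x \<noteq> 0 \<Longrightarrow> E3_form \<epsilon> x x > 0"
    proof (cases "\<epsilon> = 1")
      case False
      assume "x \<noteq> 0"
      have \<epsilon>: "\<epsilon> = -1" using assms False by simp
      let ?p = "(fst y $ 2, fst y $ 3)"
      show ?thesis
        unfolding \<epsilon> E3_form_Lorentz power2_eq_square[symmetric]
      proof (rule lorentz_orthogonal_pos)
        show "?p \<bullet> ?p = (fst y $ 1)\<^sup>2 - (1 + b\<^sup>2)"
          using y unfolding Q2_R_eq \<epsilon> E3_form_Lorentz by (simp add: power2_eq_square)
        show "?p \<bullet> (x $ 2, x $ 3) = fst y $ 1 * x $ 1"
          using v unfolding \<epsilon> E3_form_Lorentz xt by simp
        show "(x $ 2, x $ 3) \<noteq> 0 \<or> x $ 1 \<noteq> 0" using \<open>x \<noteq> 0\<close> E3_eq_0 by blast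
      qed (simp add: add_pos_nonneg)
    qed (rule E3_form_pos)
    moreover have "x = 0 \<Longrightarrow> t \<noteq> 0" using v(2) xt by (auto simp: zero_prod_def)
    ultimately show "E4_form \<epsilon> v v > 0"
      unfolding xt E_form_Pair by (cases "x = 0") (auto simp: E3_simps add_pos_nonneg zero_less_mult_iff)
  qed
qed (rule E4_form)

lemma riemannian_Q4_R:
  assumes "\<epsilon> \<in> {1, -1}"
  shows "riemannian_target (E6_form \<epsilon>) (Q4_R \<epsilon>)"
proof
  fix y assume y: "y \<in> Q4_R \<epsilon>"
  have \<epsilon>0: "\<epsilon> \<noteq> 0" using assms by auto
  show "subspace (tangent_space (Q4_R \<epsilon>) y)"
    unfolding tangent_space_Q4_R[OF \<epsilon>0 y]
    by (auto intro!: subspaceI simp: horizontal_form_def E3_simps inner_simps)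
      (simp_all flip: distrib_left)
  show "pos_def_on (tangent_space (Q4_R \<epsilon>) y) (E6_form \<epsilon>)"
    unfolding tangent_space_Q4_R[OF \<epsilon>0 y] pos_def_on_def
  proof (intro ballI impI)
    fix v assume v: "v \<in> {v. horizontal_form \<epsilon> y v = 0}" "v \<noteq> 0"
    obtain z x t where xt: "v = (z, x, t)" by (cases v) auto
    have "z \<noteq> 0 \<or> x \<noteq> 0 \<Longrightarrow> z \<bullet> z + E3_form \<epsilon> x x > 0"
    proof (cases "\<epsilon> = 1")
      case True
      assume "z \<noteq> 0 \<or> x \<noteq> 0"
      then show ?thesis
        using E3_form_pos[OF True, of x] inner_gt_zero_iff[of z]
        by (cases "x = 0"; cases "z = 0") (auto simp: E3_simps add_pos_pos)
    next
      case False
      assume nz: "z \<noteq> 0 \<or> x \<noteq> 0"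
      have \<epsilon>: "\<epsilon> = -1" using assms False by simp
      let ?p = "(fst y, fst (snd y) $ 2, fst (snd y) $ 3)"
      have "(z, x $ 2, x $ 3) \<bullet> (z, x $ 2, x $ 3) - (x $ 1)\<^sup>2 > 0"
      proof (rule lorentz_orthogonal_pos)
        show "?p \<bullet> ?p = (fst (snd y) $ 1)\<^sup>2 - 1"
          using y unfolding Q4_R_eq \<epsilon> horizontal_form_def E3_form_Lorentz by (simp add: power2_eq_square)
        show "?p \<bullet> (z, x $ 2, x $ 3) = fst (snd y) $ 1 * x $ 1"
          using v unfolding \<epsilon> horizontal_form_def E3_form_Lorentz xt by simp
        show "(z, x $ 2, x $ 3) \<noteq> 0 \<or> x $ 1 \<noteq> 0" using nz E3_eq_0[of x] by (auto simp: zero_prod_def)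
      qed simp
      then show ?thesis unfolding \<epsilon> E3_form_Lorentz by (simp add: power2_eq_square)
    qed
    moreover have "z = 0 \<Longrightarrow> x = 0 \<Longrightarrow> t \<noteq> 0" using v(2) xt by (auto simp: zero_prod_def)
    ultimately show "E6_form \<epsilon> v v > 0"
      unfolding xt E_form_Pair
      by (cases "z = 0 \<and> x = 0") (auto simp: E3_simps add_pos_nonneg zero_less_mult_iff simp flip: add.assoc)
  qed
qed (rule E6_form)

section \<open>The moving frame of the circle\<close>

definition circle_tangent :: "real \<Rightarrow> real \<Rightarrow> real^2" where
  "circle_tangent b s = vector [- sin (s / b), cos (s / b)]"

lemma circle_pt_has_derivative:
  assumes "b \<noteq> 0"
  shows "(circle_pt b has_derivative (\<lambda>r. r *\<^sub>R circle_tangent b s)) (at s)"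
proof (subst has_derivative_componentwise_within, intro ballI)
  fix i :: "real^2" assume "i \<in> Basis"
  then obtain k :: 2 where i: "i = axis k 1" by (auto simp: Basis_vec_def)
  have k: "k = 1 \<or> k = 2" using exhaust_2 by blast
  show "((\<lambda>x. circle_pt b x \<bullet> i) has_derivative (\<lambda>x. x *\<^sub>R circle_tangent b s \<bullet> i)) (at s)"
    using k assms unfolding i inner_axis circle_pt_def circle_tangent_def
    by (auto intro!: derivative_eq_intros)
qed

lemma circle_frame:
  "circle_tangent b s \<bullet> circle_tangent b s = 1" "circle_pt b s \<bullet> circle_tangent b s = 0"
  "b \<noteq> 0 \<Longrightarrow> z \<bullet> circle_tangent b s = 0 \<Longrightarrow> z \<bullet> circle_pt b s = 0 \<Longrightarrow> z = 0"
proof -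
  show "circle_tangent b s \<bullet> circle_tangent b s = 1"
    using sin_cos_squared_add[of "s / b"]
    by (simp add: circle_tangent_def inner_vec_def sum_2 power2_eq_square)
  show "circle_pt b s \<bullet> circle_tangent b s = 0"
    by (simp add: circle_pt_def circle_tangent_def inner_vec_def sum_2)
  assume b: "b \<noteq> 0" and z: "z \<bullet> circle_tangent b s = 0" "z \<bullet> circle_pt b s = 0"
  let ?c = "cos (s / b)" and ?s = "sin (s / b)"
  have 1: "z $ 2 * ?c = z $ 1 * ?s"
    using z(1) by (simp add: circle_tangent_def inner_vec_def sum_2)
  have "b * (z $ 1 * ?c + z $ 2 * ?s) = 0"
    using z(2) by (simp add: circle_pt_def inner_vec_def sum_2 algebra_simps)
  then have 2: "z $ 1 * ?c + z $ 2 * ?s = 0" using b by simp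
  have p: "?c * ?c + ?s * ?s = 1"
    using sin_cos_squared_add2[of "s / b"] by (simp add: power2_eq_square)
  have "z $ 1 = z $ 1 * (?c * ?c + ?s * ?s)" "z $ 2 = z $ 2 * (?c * ?c + ?s * ?s)" by (simp_all only: p mult_1_right)
  moreover have "z $ 1 * (?c * ?c + ?s * ?s) = ?c * (z $ 1 * ?c + z $ 2 * ?s) + ?s * (z $ 1 * ?s - z $ 2 * ?c)"
    "z $ 2 * (?c * ?c + ?s * ?s) = ?s * (z $ 1 * ?c + z $ 2 * ?s) - ?c * (z $ 1 * ?s - z $ 2 * ?c)"
    by algebra+
  ultimately have "z $ 1 = 0" "z $ 2 = 0" using 1 2 by auto
  then show "z = 0" by (simp add: vec_eq_iff forall_2)
qed


section \<open>Products of a circle with a minimal surface\<close>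

text \<open>\<open>X\<close> is \<open>f\<close> in an arbitrary chart of \<open>M\<close>,
  \<open>\<Phi>\<close> is the surface in one of its charts, and \<open>\<theta>\<close> passes from
  the former chart to coordinates adapted to the product. All hypotheses on \<open>f\<close> can
  thus be taken in the chart in which they are given.\<close>

locale circle_cylinder =
  fixes \<epsilon> b :: real and U :: "(real^3) set" and X :: "real^3 \<Rightarrow> (real^2) \<times> (real^3) \<times> real"
    and V :: "(real^2) set" and \<Phi> :: "real^2 \<Rightarrow> (real^3) \<times> real" and \<theta> :: "real^3 \<Rightarrow> (real^2) \<times> real"
  assumes eps: "\<epsilon> \<in> {1, -1}" and b: "b > 0" "b\<^sup>2 \<noteq> \<epsilon>"
    and X_immersion: "param_immersion (E6_form \<epsilon>) (Q4_R \<epsilon>) U X"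
    and \<Phi>_immersion: "param_immersion (E4_form \<epsilon>) (Q2_R \<epsilon> b) V \<Phi>"
    and \<theta>: "twice_diff_on U \<theta>" "\<And>u. u \<in> U \<Longrightarrow> fst (\<theta> u) \<in> V"
    and X_eq: "\<And>u. u \<in> U \<Longrightarrow> X u = (circle_pt b (snd (\<theta> u)), \<Phi> (fst (\<theta> u)))"
    and minimal: "\<And>v. v \<in> V \<Longrightarrow> mean_curv (E4_form \<epsilon>) (Q2_R \<epsilon> b) \<Phi> v = 0"
    and T\<^sub>\<Phi>_nonzero: "\<And>v. v \<in> V \<Longrightarrow> tangent_part (E4_form \<epsilon>) (Q2_R \<epsilon> b) dt4 \<Phi> v \<noteq> 0"
    and mean_curv_nonzero: "\<And>u. u \<in> U \<Longrightarrow> mean_curv (E6_form \<epsilon>) (Q4_R \<epsilon>) X u \<noteq> 0"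
    and parallel: "\<And>u v. u \<in> U \<Longrightarrow>
      normal_conn (E6_form \<epsilon>) (Q4_R \<epsilon>) X (mean_curv (E6_form \<epsilon>) (Q4_R \<epsilon>) X) u v = 0"
begin

sublocale X: param_immersion "E6_form \<epsilon>" "Q4_R \<epsilon>" U X by (rule X_immersion)
sublocale \<Phi>: param_immersion "E4_form \<epsilon>" "Q2_R \<epsilon> b" V \<Phi> by (rule \<Phi>_immersion)

abbreviation "c \<equiv> \<epsilon> - b\<^sup>2"
abbreviation "h \<equiv> induced_metric (E6_form \<epsilon>) X"
abbreviation "H \<equiv> mean_curv (E6_form \<epsilon>) (Q4_R \<epsilon>) X"
abbreviation "T \<equiv> tangent_part (E6_form \<epsilon>) (Q4_R \<epsilon>) dt6 X"
abbreviation "P u v \<equiv> fst (deriv_at \<theta> u v)"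
abbreviation "\<sigma> u v \<equiv> snd (deriv_at \<theta> u v)"

section \<open>Derivatives and normals in the product splitting\<close>

lemma eps_simps: "\<epsilon> \<noteq> 0" "\<epsilon> * \<epsilon> = 1" "c \<noteq> 0"
  using eps b by auto

lemma tangent_Q4_R:
  assumes u: "u \<in> U"
  shows "v \<in> tangent_space (Q4_R \<epsilon>) (X u) \<longleftrightarrow> horizontal_form \<epsilon> (X u) v = 0"
  using tangent_space_Q4_R[OF eps_simps(1) X.into[OF u]] by simp

lemma tangent_Q2_R:
  assumes v: "v \<in> V"
  shows "w \<in> tangent_space (Q2_R \<epsilon> b) (\<Phi> v) \<longleftrightarrow> E3_form \<epsilon> (fst (\<Phi> v)) (fst w) = 0"
  using tangent_space_Q2_R[of \<epsilon> b] b(2) \<Phi>.into[OF v] by auto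

lemma deriv_X:
  assumes u: "u \<in> U"
  shows "deriv_at X u v = (\<sigma> u v *\<^sub>R circle_tangent b (snd (\<theta> u)), deriv_at \<Phi> (fst (\<theta> u)) (P u v))"
proof -
  have b0: "b \<noteq> 0" using b by simp
  have d\<theta>: "(\<theta> has_derivative deriv_at \<theta> u) (at u)" by (rule twice_diff_onD(4)[OF \<theta>(1) u])
  have "((\<lambda>u. (circle_pt b (snd (\<theta> u)), \<Phi> (fst (\<theta> u)))) has_derivative
     (\<lambda>v. (\<sigma> u v *\<^sub>R circle_tangent b (snd (\<theta> u)), deriv_at \<Phi> (fst (\<theta> u)) (P u v)))) (at u)"
    by (intro has_derivative_Pair has_derivative_compose[OF has_derivative_snd[OF d\<theta>] circle_pt_has_derivative[OF b0]]
        has_derivative_compose[OF has_derivative_fst[OF d\<theta>] twice_diff_onD(4)[OF \<Phi>.twice_diff \<theta>(2)[OF u]]])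
  moreover have "\<forall>\<^sub>F u' in nhds u. X u' = (circle_pt b (snd (\<theta> u')), \<Phi> (fst (\<theta> u')))"
    using twice_diff_onD(1)[OF \<theta>(1)] u X_eq by (rule eventually_nhds_openI)
  ultimately show ?thesis by (simp add: deriv_at_cong_ev(1) deriv_at_eqI)
qed

text \<open>\<open>X\<close> factors through \<open>\<theta>\<close>, so injectivity of its
  differential passes to that of \<open>\<theta>\<close>, and the dimensions agree. This yields
  vectors with prescribed surface and circle components.\<close>

lemma deriv_\<theta>_surj:
  assumes u: "u \<in> U"
  obtains v where "deriv_at \<theta> u v = w"
proof -
  have lin: "linear (deriv_at \<theta> u)" by (rule twice_diff_onD(3)[OF \<theta>(1) u])
  have "inj (deriv_at \<theta> u)"
    using X.inj_deriv[OF u] by (auto simp: inj_def deriv_X[OF u])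
  then have "dim (range (deriv_at \<theta> u)) = DIM(real^3)"
    using dim_image_eq[OF lin, of UNIV] by simp
  then have "span (range (deriv_at \<theta> u)) = UNIV"
    using dim_eq_full[of "range (deriv_at \<theta> u)"] by simp
  moreover have "span (range (deriv_at \<theta> u)) = range (deriv_at \<theta> u)"
    unfolding span_eq_iff by (rule linear_subspace_image[OF lin subspace_UNIV])
  ultimately have "w \<in> range (deriv_at \<theta> u)" by simp
  then show ?thesis using that by auto
qed

text \<open>The second-order chain rule. The term with second derivatives of \<open>\<theta>\<close>
  is tangent to \<open>\<Phi>\<close>, so its value \<open>a\<close> can be forgotten when pairing
  with normals.\<close>

lemma hess_X_snd:
  assumes u: "u \<in> U"
  shows "\<exists>a. snd (hess X u v w) = hess \<Phi> (fst (\<theta> u)) (P u v) (P u w) + deriv_at \<Phi> (fst (\<theta> u)) a"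
proof -
  have "(\<lambda>u'. P u' w) differentiable (at u)"
    using deriv_at_linear_compose(2)[OF bounded_linear_fst twice_diff_onD(5)[OF \<theta>(1) u]] .
  note S = this[unfolded frechet_derivative_works]
  have d\<theta>: "((\<lambda>u. fst (\<theta> u)) has_derivative P u) (at u)"
    by (rule has_derivative_fst[OF twice_diff_onD(4)[OF \<theta>(1) u]])
  from has_derivative_deriv_at_compose[OF \<Phi>.twice_diff _ d\<theta> S, OF \<theta>(2)[OF u]]
  have "deriv_at (\<lambda>u'. deriv_at \<Phi> (fst (\<theta> u')) (P u' w)) u v
     = hess \<Phi> (fst (\<theta> u)) (P u v) (P u w) + deriv_at \<Phi> (fst (\<theta> u)) (deriv_at (\<lambda>u'. P u' w) u v)"
    by (simp add: deriv_at_eqI)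
  moreover have ev: "\<forall>\<^sub>F u' in nhds u. snd (deriv_at X u' w) = deriv_at \<Phi> (fst (\<theta> u')) (P u' w)"
    using twice_diff_onD(1)[OF \<theta>(1)] u by (rule eventually_nhds_openI) (simp add: deriv_X)
  moreover have "deriv_at (\<lambda>u'. snd (deriv_at X u' w)) u = (\<lambda>v. snd (hess X u v w))"
    by (rule deriv_at_linear_compose(1)[OF bounded_linear_snd twice_diff_onD(5)[OF X.twice_diff u]])
  ultimately have "snd (hess X u v w)
     = hess \<Phi> (fst (\<theta> u)) (P u v) (P u w) + deriv_at \<Phi> (fst (\<theta> u)) (deriv_at (\<lambda>u'. P u' w) u v)"
    unfolding deriv_at_cong_ev(1)[OF ev] by simp
  then show ?thesis by blast
qed

lemma induced_metric_X:
  assumes u: "u \<in> U"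
  shows "h u v w = induced_metric (E4_form \<epsilon>) \<Phi> (fst (\<theta> u)) (P u v) (P u w) + \<sigma> u v * \<sigma> u w"
  by (simp add: induced_metric_def deriv_X[OF u] E_form_Pair circle_frame)

lemma lift_normal:
  assumes u: "u \<in> U" and n: "n \<in> normal_space (E4_form \<epsilon>) (Q2_R \<epsilon> b) \<Phi> (fst (\<theta> u))"
  shows "(0, n) \<in> normal_space (E6_form \<epsilon>) (Q4_R \<epsilon>) X u"
  using \<Phi>.normal_spaceD(1,2)[OF n]
  unfolding normal_space_def tangent_Q4_R[OF u] tangent_Q2_R[OF \<theta>(2)[OF u]]
  by (simp add: deriv_X[OF u] E_form_Pair horizontal_form_def X_eq[OF u])

text \<open>Against a lifted normal only the surface bends: the second fundamental form of
  \<open>X\<close> is the pullback of that of \<open>\<Phi>\<close> by \<open>P\<close>, a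
  Riemannian submersion at each point. The trace is therefore that of the minimal surface.\<close>

lemma mean_curv_lift_normal:
  assumes u: "u \<in> U" and n: "n \<in> normal_space (E4_form \<epsilon>) (Q2_R \<epsilon> b) \<Phi> (fst (\<theta> u))"
  shows "E6_form \<epsilon> (H u) (0, n) = 0"
proof -
  let ?v = "fst (\<theta> u)"
  note v = \<theta>(2)[OF u]
  let ?\<beta> = "\<lambda>v w. E4_form \<epsilon> (hess \<Phi> ?v v w) n"
  have hX: "E6_form \<epsilon> (hess X u v w) (0, n) = ?\<beta> (P u v) (P u w)" for v w
  proof -
    obtain a where "snd (hess X u v w) = hess \<Phi> ?v (P u v) (P u w) + deriv_at \<Phi> ?v a"
      using hess_X_snd[OF u] by blast
    moreover have "E6_form \<epsilon> (hess X u v w) (0, n) = E4_form \<epsilon> (snd (hess X u v w)) n"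
      by (cases "hess X u v w") (simp add: E_form_Pair)
    ultimately show ?thesis using \<Phi>.normal_spaceD(3)[OF n] by (simp add: \<Phi>.g_simps)
  qed
  have "bilinear ?\<beta>"
  proof -
    note bl = bilinear_hess[OF \<Phi>.twice_diff v]
    show ?thesis
      unfolding bilinear_def
      by (auto intro!: linearI simp: \<Phi>.g_simps bilinear_ladd[OF bl] bilinear_radd[OF bl]
          bilinear_lmul[OF bl] bilinear_rmul[OF bl])
  qed
  moreover have "\<exists>v. P u v = w \<and> (\<forall>v'. h u v v' = induced_metric (E4_form \<epsilon>) \<Phi> ?v w (P u v'))" for w
  proof -
    obtain v where "deriv_at \<theta> u v = (w, 0)" by (rule deriv_\<theta>_surj[OF u])
    then show ?thesis by (intro exI[of _ v]) (simp add: induced_metric_X[OF u])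
  qed
  ultimately have "metric_trace (h u) (\<lambda>v w. ?\<beta> (P u v) (P u w))
     = metric_trace (induced_metric (E4_form \<epsilon>) \<Phi> ?v) ?\<beta>"
    by (intro metric_trace_riemannian_submersion X.induced_form[OF u] \<Phi>.induced_form[OF v])
  also have "\<dots> = 0"
    using \<Phi>.normal_component_mean_curv[OF v n] minimal[OF v] by (simp add: \<Phi>.g_simps)
  finally show ?thesis
    using X.normal_component_mean_curv[OF u lift_normal[OF u n]] by (simp add: hX)
qed

text \<open>\<open>Z (X u)\<close> is normal to the hypersurface \<open>S\<^sup>1(b) \<times> \<rat>\<^sup>2\<^sub>a \<times> \<real>\<close>.\<close>

definition Z :: "(real^2) \<times> (real^3) \<times> real \<Rightarrow> (real^2) \<times> (real^3) \<times> real" where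
  "Z y = (c *\<^sub>R fst y, - (b\<^sup>2) *\<^sub>R fst (snd y), 0)"

lemma bounded_linear_Z: "bounded_linear Z"
  unfolding linear_conv_bounded_linear[symmetric] Z_def
  by (auto intro!: linearI simp: algebra_simps)

lemma Z_form: "E6_form \<epsilon> y (Z w) = c * (fst y \<bullet> fst w) - b\<^sup>2 * E3_form \<epsilon> (fst (snd y)) (fst (snd w))"
  by (cases y rule: prod_cases3) (simp add: Z_def E_form_Pair E3_simps)

lemma X_point:
  assumes u: "u \<in> U"
  shows "fst (X u) \<bullet> fst (X u) = b\<^sup>2" "E3_form \<epsilon> (fst (snd (X u))) (fst (snd (X u))) = c"
  using X_eq[OF u] \<Phi>.into[OF \<theta>(2)[OF u]] by (simp_all add: circle_pt_inner Q2_R_eq)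

lemma E3_deriv_X:
  assumes u: "u \<in> U"
  shows "E3_form \<epsilon> (fst (snd (X u))) (fst (snd (deriv_at X u v))) = 0"
  using \<Phi>.deriv_tangent[OF \<theta>(2)[OF u]] X_eq[OF u]
  by (simp add: deriv_X[OF u] tangent_Q2_R[OF \<theta>(2)[OF u]])

lemma Z_normal:
  assumes u: "u \<in> U"
  shows "Z (X u) \<in> normal_space (E6_form \<epsilon>) (Q4_R \<epsilon>) X u"
proof -
  \<comment> \<open>The weights \<open>c\<close> and \<open>-(b\<^sup>2)\<close> are made for this:
    the two parts of the position vector have squares \<open>b\<^sup>2\<close> and \<open>c\<close>,
    so the contributions cancel.\<close>
  have "horizontal_form \<epsilon> (X u) (Z (X u)) = 0"
    using X_point[OF u] by (simp add: horizontal_form_def Z_def E3_simps)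
  moreover have "E6_form \<epsilon> (deriv_at X u v) (Z (X u)) = 0" for v
    using E3_deriv_X[OF u, of v]
    by (simp add: Z_form symmetric_formD(2)[OF E3_form, of _ "fst (snd (deriv_at X u v))"])
      (simp add: deriv_X[OF u] X_eq[OF u] circle_frame inner_commute[of "circle_tangent _ _"])
  ultimately show ?thesis
    unfolding normal_space_def using tangent_Q4_R[OF u] X.g_commute by simp
qed

lemma Z_norm:
  assumes u: "u \<in> U"
  shows "E6_form \<epsilon> (Z (X u)) (Z (X u)) = \<epsilon> * b\<^sup>2 * c"
proof -
  have "E6_form \<epsilon> (Z (X u)) (Z (X u)) = c * (c * b\<^sup>2) + b\<^sup>2 * (b\<^sup>2 * c)"
    unfolding Z_form using X_point[OF u] by (simp add: Z_def E3_simps)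
  then show ?thesis by (simp add: algebra_simps)
qed

text \<open>Replaces a dimension count for the normal space. Tangency to the target and
  orthogonality to \<open>Z\<close> are two equations for the circle and \<open>real^3\<close>
  pairings with the position vector; eliminating one leaves
  \<open>c + b\<^sup>2 = \<epsilon>\<close> times the other. Both pairings vanish, and orthogonality
  to the circle direction then kills \<open>z\<close>.\<close>

lemma normal_orthogonal_Z:
  assumes u: "u \<in> U" and \<xi>: "\<xi> \<in> normal_space (E6_form \<epsilon>) (Q4_R \<epsilon>) X u"
    and "E6_form \<epsilon> \<xi> (Z (X u)) = 0"
  obtains n where "\<xi> = (0, n)" "n \<in> normal_space (E4_form \<epsilon>) (Q2_R \<epsilon> b) \<Phi> (fst (\<theta> u))"
proof -
  obtain z n where zn: "\<xi> = (z, n)" by (cases \<xi>)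
  have 1: "fst (X u) \<bullet> z + E3_form \<epsilon> (fst (snd (X u))) (fst n) = 0"
    using X.normal_spaceD(1)[OF \<xi>] unfolding tangent_Q4_R[OF u] by (simp add: horizontal_form_def zn)
  have 2: "c * (fst (X u) \<bullet> z) - b\<^sup>2 * E3_form \<epsilon> (fst (snd (X u))) (fst n) = 0"
    using assms(3) unfolding Z_form zn
    by (simp add: inner_commute symmetric_formD(2)[OF E3_form, of _ "fst n"])
  have E3: "E3_form \<epsilon> (fst (snd (X u))) (fst n) = - (fst (X u) \<bullet> z)" using 1 by simp
  have "\<epsilon> * (fst (X u) \<bullet> z) = 0" using 2 unfolding E3 by (simp add: algebra_simps)
  then have z1: "fst (X u) \<bullet> z = 0" using eps_simps by simp
  obtain l where l: "deriv_at \<theta> u l = (0, 1)" by (rule deriv_\<theta>_surj[OF u])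
  have "deriv_at X u l = (circle_tangent b (snd (\<theta> u)), 0)"
    by (simp add: deriv_X[OF u] l linear_0[OF \<Phi>.linear_deriv[OF \<theta>(2)[OF u]]])
  then have "z \<bullet> circle_tangent b (snd (\<theta> u)) = 0"
    using X.normal_spaceD(2)[OF \<xi>, of l] by (simp add: zn E_form_Pair \<Phi>.g_simps)
  then have z: "z = 0"
    using circle_frame(3)[of b z "snd (\<theta> u)"] z1 b(1) X_eq[OF u] by (simp add: inner_commute)
  have "E4_form \<epsilon> n (deriv_at \<Phi> (fst (\<theta> u)) w) = 0" for w
  proof -
    obtain v where "deriv_at \<theta> u v = (w, 0)" by (rule deriv_\<theta>_surj[OF u])
    then show ?thesis
      using X.normal_spaceD(2)[OF \<xi>, of v] by (simp add: zn z deriv_X[OF u] E_form_Pair)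
  qed
  moreover have "E3_form \<epsilon> (fst (\<Phi> (fst (\<theta> u)))) (fst n) = 0"
    using E3 z1 X_eq[OF u] by simp
  ultimately have "n \<in> normal_space (E4_form \<epsilon>) (Q2_R \<epsilon> b) \<Phi> (fst (\<theta> u))"
    unfolding normal_space_def using tangent_Q2_R[OF \<theta>(2)[OF u]] by simp
  then show ?thesis using that zn z by blast
qed

section \<open>The vertical field and the mean curvature vector\<close>

lemma dt6_tangent: "u \<in> U \<Longrightarrow> dt6 \<in> tangent_space (Q4_R \<epsilon>) (X u)"
  by (simp add: tangent_Q4_R horizontal_form_def dt6_def E3_simps)

lemma dt6_form: "E6_form \<epsilon> dt6 y = snd (snd y)" "E6_form \<epsilon> y dt6 = snd (snd y)"
  by (cases y rule: prod_cases3, simp add: dt6_def E_form_Pair E3_simps)+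

lemma dt4_form: "E4_form \<epsilon> dt4 y = snd y"
  by (cases y) (simp add: dt4_def E_form_Pair E3_simps)

text \<open>Differentiating the orthogonality of \<open>Z\<close> to the coordinate fields moves the
  derivative onto \<open>Z\<close>. As \<open>Z\<close> scales the three factors by the constants
  \<open>c\<close>, \<open>-(b\<^sup>2)\<close> and \<open>0\<close>, the result is a combination of
  the metric, the circle part and the height part; \<open>c + b\<^sup>2 = \<epsilon>\<close> gives
  the middle coefficient.\<close>

lemma hess_X_Z:
  assumes u: "u \<in> U"
  shows "E6_form \<epsilon> (hess X u v w) (Z (X u))
    = b\<^sup>2 * h u v w + (- \<epsilon>) * (\<sigma> u v * \<sigma> u w) + (- (b\<^sup>2)) * (h u v (T u) * h u w (T u))"
proof -
  have bb: "bounded_bilinear (E6_form \<epsilon>)"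
    using symmetric_formD(1)[OF E6_form] bilinear_conv_bounded_bilinear by blast
  have dZ: "((\<lambda>u. Z (X u)) has_derivative (\<lambda>v. Z (deriv_at X u v))) (at u)"
    by (rule bounded_linear.has_derivative[OF bounded_linear_Z twice_diff_onD(4)[OF X.twice_diff u]])
  from bounded_bilinear.FDERIV[OF bb twice_diff_onD(6)[OF X.twice_diff u, of w] dZ]
  have "deriv_at (\<lambda>u. E6_form \<epsilon> (deriv_at X u w) (Z (X u))) u v
     = E6_form \<epsilon> (deriv_at X u w) (Z (deriv_at X u v)) + E6_form \<epsilon> (hess X u v w) (Z (X u))"
    by (simp add: deriv_at_eqI)
  moreover have "\<forall>\<^sub>F u' in nhds u. E6_form \<epsilon> (deriv_at X u' w) (Z (X u')) = 0"
    using twice_diff_onD(1)[OF \<theta>(1)] u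
    by (rule eventually_nhds_openI) (rule X.normal_spaceD(3)[OF Z_normal])
  from deriv_at_cong_ev(1)[OF this]
  have "deriv_at (\<lambda>u. E6_form \<epsilon> (deriv_at X u w) (Z (X u))) u v = 0" by simp
  ultimately have *: "E6_form \<epsilon> (hess X u v w) (Z (X u)) = - E6_form \<epsilon> (deriv_at X u w) (Z (deriv_at X u v))"
    by simp
  have t: "snd (snd (deriv_at X u v)) = h u v (T u)" for v
    using X.induced_metric_tangent_part[OF u dt6_tangent[OF u], of v]
      symmetric_formD(2)[OF X.induced_form(1)[OF u]] by (simp add: dt6_form)
  have z: "fst (deriv_at X u v) \<bullet> fst (deriv_at X u w) = \<sigma> u v * \<sigma> u w"
    by (simp add: deriv_X[OF u] circle_frame)
  have "h u v w = fst (deriv_at X u v) \<bullet> fst (deriv_at X u w)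
      + E3_form \<epsilon> (fst (snd (deriv_at X u v))) (fst (snd (deriv_at X u w)))
      + snd (snd (deriv_at X u v)) * snd (snd (deriv_at X u w))"
    unfolding induced_metric_def
    by (cases "deriv_at X u v" rule: prod_cases3; cases "deriv_at X u w" rule: prod_cases3)
      (simp add: E_form_Pair)
  then have x: "E3_form \<epsilon> (fst (snd (deriv_at X u w))) (fst (snd (deriv_at X u v)))
     = h u v w - \<sigma> u v * \<sigma> u w - h u v (T u) * h u w (T u)"
    unfolding z t using symmetric_formD(2)[OF E3_form] by simp
  have "E6_form \<epsilon> (deriv_at X u w) (Z (deriv_at X u v))
      = c * (\<sigma> u v * \<sigma> u w) - b\<^sup>2 * (h u v w - \<sigma> u v * \<sigma> u w - h u v (T u) * h u w (T u))"
    unfolding Z_form x using z by (simp add: inner_commute)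
  then show ?thesis unfolding * by (simp add: algebra_simps)
qed

lemma mean_curv_Z:
  assumes u: "u \<in> U"
  shows "3 * E6_form \<epsilon> (H u) (Z (X u)) = 3 * b\<^sup>2 - \<epsilon> - b\<^sup>2 * h u (T u) (T u)"
proof -
  \<comment> \<open>\<open>l\<close> is the unit vector along the circle; it represents
    \<open>\<sigma> u\<close> in the metric, so the circle term is a rank-one form of trace
    1.\<close>
  obtain l where l: "deriv_at \<theta> u l = (0, 1)" by (rule deriv_\<theta>_surj[OF u])
  have hl: "h u v l = \<sigma> u v" for v
    using linear_0[OF \<Phi>.linear_deriv[OF \<theta>(2)[OF u]]]
    by (simp add: induced_metric_X[OF u] l) (simp add: induced_metric_def \<Phi>.g_simps)
  have "metric_trace (h u) (\<lambda>v w. \<sigma> u v * \<sigma> u w) = 1"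
    using metric_trace_squares[OF X.induced_form[OF u], of l l] by (simp add: hl l)
  moreover have "metric_trace (h u) (\<lambda>v w. h u v (T u) * h u w (T u)) = h u (T u) (T u)"
    by (rule metric_trace_squares[OF X.induced_form[OF u]])
  moreover have "metric_trace (h u) (h u) = 3"
    using metric_trace_self[OF X.induced_form[OF u]] by simp
  ultimately have "metric_trace (h u) (\<lambda>v w. E6_form \<epsilon> (hess X u v w) (Z (X u)))
      = 3 * b\<^sup>2 - \<epsilon> - b\<^sup>2 * h u (T u) (T u)"
    unfolding hess_X_Z[OF u] metric_trace_linear(2,3) by simp
  then show ?thesis using X.normal_component_mean_curv[OF u Z_normal[OF u]] by simp
qed

text \<open>The quotient of the product of \<open>H\<close> with \<open>Z\<close> by the square of
  \<open>Z\<close>. The squared length of \<open>T\<close> is written as the height component of its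
  image, whose dependence on \<open>u\<close> can be differentiated directly.\<close>

definition k :: "real^3 \<Rightarrow> real" where
  "k u = (3 * b\<^sup>2 - \<epsilon> - b\<^sup>2 * snd (snd (deriv_at X u (T u)))) / (3 * (\<epsilon> * b\<^sup>2 * c))"

text \<open>The remainder \<open>\<xi>\<close> is normal and orthogonal to \<open>Z\<close>, hence a
  lifted normal of the surface. Minimality makes \<open>H\<close> orthogonal to it as well, so
  \<open>\<xi>\<close> is orthogonal to itself.\<close>

lemma mean_curv_eq:
  assumes u: "u \<in> U"
  shows "H u = k u *\<^sub>R Z (X u)"
proof -
  have ne: "\<epsilon> * b\<^sup>2 * c \<noteq> 0" using eps_simps b by auto
  have hT: "h u (T u) (T u) = snd (snd (deriv_at X u (T u)))"
    using X.induced_metric_tangent_part[OF u dt6_tangent[OF u]] by (simp add: dt6_form)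
  then have HZ: "E6_form \<epsilon> (H u) (Z (X u)) = k u * (\<epsilon> * b\<^sup>2 * c)"
  proof -
    have "x / (3 * y) * y = x / 3" if "y \<noteq> 0" for x y :: real using that by simp
    from this[OF ne] have kk: "k u * (\<epsilon> * b\<^sup>2 * c) = (3 * b\<^sup>2 - \<epsilon> - b\<^sup>2 * h u (T u) (T u)) / 3"
      unfolding k_def hT .
    show ?thesis unfolding kk using mean_curv_Z[OF u] by simp
  qed
  define \<xi> where "\<xi> = H u - k u *\<^sub>R Z (X u)"
  have \<xi>: "\<xi> \<in> normal_space (E6_form \<epsilon>) (Q4_R \<epsilon>) X u"
    unfolding \<xi>_def
    by (intro subspace_diff subspace_scale X.normal_space(1)[OF u] X.mean_curv_normal[OF u] Z_normal[OF u])
  have \<xi>Z: "E6_form \<epsilon> \<xi> (Z (X u)) = 0"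
    unfolding \<xi>_def by (simp add: X.g_simps HZ Z_norm[OF u])
  obtain n where n: "\<xi> = (0, n)" "n \<in> normal_space (E4_form \<epsilon>) (Q2_R \<epsilon> b) \<Phi> (fst (\<theta> u))"
    using normal_orthogonal_Z[OF u \<xi> \<xi>Z] .
  have "E6_form \<epsilon> \<xi> \<xi> = E6_form \<epsilon> (H u) \<xi> - k u * E6_form \<epsilon> (Z (X u)) \<xi>"
    by (subst \<xi>_def) (simp add: X.g_simps)
  also have "\<dots> = 0"
    using mean_curv_lift_normal[OF u n(2)] \<xi>Z X.g_commute n(1) by simp
  finally have "\<xi> = 0" using pos_def_onD[OF X.normal_space(2)[OF u] \<xi>] by simp
  then show ?thesis by (simp add: \<xi>_def)
qed

lemma T_differentiable: "u \<in> U \<Longrightarrow> T differentiable (at u)"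
  using tangent_part_differentiable[OF X_immersion, of u dt6] dt6_tangent by simp

lemma k_differentiable:
  assumes u: "u \<in> U"
  shows "k differentiable (at u)"
proof -
  have "(\<lambda>u'. deriv_at X u' (T u')) differentiable (at u)"
    using has_derivative_deriv_at_compose[OF X.twice_diff, of "\<lambda>x. x" u, OF u has_derivative_ident
        T_differentiable[OF u, unfolded frechet_derivative_works]]
    unfolding differentiable_def by blast
  from deriv_at_linear_compose(2)[OF bounded_linear_compose[OF bounded_linear_snd bounded_linear_snd] this]
  show ?thesis
    unfolding k_def using eps_simps b by (intro differentiable_divide) simp_all
qed

text \<open>The derivative of \<open>H = k Z\<close> has normal component \<open>k b\<^sup>2 t(v) n\<^sub>t\<close> along \<open>(0, n)\<close>.\<close>

lemma normal_height_zero: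
  assumes u: "u \<in> U" and n: "n \<in> normal_space (E4_form \<epsilon>) (Q2_R \<epsilon> b) \<Phi> (fst (\<theta> u))"
  shows "snd n = 0"
proof -
  let ?\<xi> = "(0, n)"
  note v = \<theta>(2)[OF u]
  note \<xi> = lift_normal[OF u n]
  have dZ: "((\<lambda>u. Z (X u)) has_derivative (\<lambda>v. Z (deriv_at X u v))) (at u)"
    by (rule bounded_linear.has_derivative[OF bounded_linear_Z twice_diff_onD(4)[OF X.twice_diff u]])
  have dk: "(k has_derivative deriv_at k u) (at u)"
    using k_differentiable[OF u] unfolding frechet_derivative_works .
  have "deriv_at (\<lambda>u. k u *\<^sub>R Z (X u)) u w = k u *\<^sub>R Z (deriv_at X u w) + deriv_at k u w *\<^sub>R Z (X u)" for w
    using deriv_at_eqI[OF has_derivative_scaleR[OF dk dZ]] by simp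
  moreover have "\<forall>\<^sub>F u' in nhds u. H u' = k u' *\<^sub>R Z (X u')"
    using twice_diff_onD(1)[OF \<theta>(1)] u mean_curv_eq by (rule eventually_nhds_openI)
  ultimately have dH: "deriv_at H u w = k u *\<^sub>R Z (deriv_at X u w) + deriv_at k u w *\<^sub>R Z (X u)" for w
    by (simp add: deriv_at_cong_ev(1))
  have k: "k u \<noteq> 0" using mean_curv_nonzero[OF u] mean_curv_eq[OF u] by auto
  have Z0: "E6_form \<epsilon> (Z (X u)) ?\<xi> = 0"
  proof -
    have "E3_form \<epsilon> (fst (snd (X u))) (fst n) = 0"
      using \<Phi>.normal_spaceD(1)[OF n] tangent_Q2_R[OF v] X_eq[OF u] by simp
    then show ?thesis
      using Z_form[of ?\<xi> "X u"] X.g_commute symmetric_formD(2)[OF E3_form, of _ "fst n"] by simp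
  qed
  \<comment> \<open>The term with the derivative of \<open>k\<close> vanishes by \<open>Z0\<close>.
    What remains is \<open>-(b\<^sup>2)\<close> times the pairing of the \<open>real^3\<close>
    parts, and \<open>\<xi>\<close> being normal equates that pairing with minus the product of the
    heights.\<close>
  have prod0: "snd n * snd (snd (deriv_at X u w)) = 0" for w
  proof -
    have "E6_form \<epsilon> (deriv_at H u w) ?\<xi> = 0"
      using X.normal_component_normal_conn[OF u \<xi>, of H w] parallel[OF u, of w] by (simp add: X.g_simps)
    then have "E6_form \<epsilon> (Z (deriv_at X u w)) ?\<xi> = 0"
      using k by (simp add: dH X.g_simps Z0)
    then have "b\<^sup>2 * E3_form \<epsilon> (fst n) (fst (snd (deriv_at X u w))) = 0"
      using Z_form[of ?\<xi> "deriv_at X u w"] X.g_commute by simp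
    then have "E3_form \<epsilon> (fst n) (fst (snd (deriv_at X u w))) = 0" using b by simp
    moreover have "E6_form \<epsilon> ?\<xi> (deriv_at X u w)
        = E3_form \<epsilon> (fst n) (fst (snd (deriv_at X u w))) + snd n * snd (snd (deriv_at X u w))"
      by (cases n; cases "deriv_at X u w" rule: prod_cases3) (simp add: E_form_Pair)
    ultimately show ?thesis using X.normal_spaceD(2)[OF \<xi>, of w] by simp
  qed
  show ?thesis
  proof (rule ccontr)
    assume "snd n \<noteq> 0"
    \<comment> \<open>A nonzero height of \<open>n\<close> at this one point would make the surface
      horizontal to first order there, so the vertical vector would be normal to
      \<open>\<Phi>\<close> and its tangent part zero.\<close>
    then have t0: "snd (snd (deriv_at X u w)) = 0" for w using prod0 by simp
    have "snd (deriv_at \<Phi> (fst (\<theta> u)) w) = 0" for w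
    proof -
      obtain v where "deriv_at \<theta> u v = (w, 0)" by (rule deriv_\<theta>_surj[OF u])
      then show ?thesis using t0[of v] by (simp add: deriv_X[OF u])
    qed
    then have "E4_form \<epsilon> dt4 (deriv_at \<Phi> (fst (\<theta> u)) w) = 0" for w
      by (simp add: dt4_form)
    then have "dt4 - deriv_at \<Phi> (fst (\<theta> u)) 0 \<in> normal_space (E4_form \<epsilon>) (Q2_R \<epsilon> b) \<Phi> (fst (\<theta> u))"
      unfolding normal_space_def using tangent_Q2_R[OF v]
      by (simp add: linear_0[OF \<Phi>.linear_deriv[OF v]] dt4_def E3_simps)
    from \<Phi>.tangent_part_eqI[OF v this] show False using T\<^sub>\<Phi>_nonzero[OF v] by simp
  qed
qed

text \<open>\<open>Z\<close> has no vertical component, so the normal part \<open>\<eta>\<close> of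
  \<open>dt6\<close> is orthogonal to it and is a lifted normal. Its square equals its own height,
  which is zero.\<close>

lemma deriv_X_T:
  assumes u: "u \<in> U"
  shows "deriv_at X u (T u) = dt6"
proof -
  define \<eta> where "\<eta> = dt6 - deriv_at X u (T u)"
  have \<eta>: "\<eta> \<in> normal_space (E6_form \<epsilon>) (Q4_R \<epsilon>) X u"
    unfolding \<eta>_def by (rule X.tangent_part_normal[OF u dt6_tangent[OF u]])
  have "E6_form \<epsilon> \<eta> (Z (X u)) = 0"
    unfolding \<eta>_def using X.normal_spaceD(3)[OF Z_normal[OF u]]
    by (simp add: X.g_simps dt6_form Z_def)
  then obtain n where n: "\<eta> = (0, n)" "n \<in> normal_space (E4_form \<epsilon>) (Q2_R \<epsilon> b) \<Phi> (fst (\<theta> u))"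
    using normal_orthogonal_Z[OF u \<eta>] by blast
  have "E6_form \<epsilon> \<eta> \<eta> = E6_form \<epsilon> dt6 \<eta> - E6_form \<epsilon> (deriv_at X u (T u)) \<eta>"
    by (subst \<eta>_def) (simp add: X.g_simps)
  also have "\<dots> = 0"
    using X.normal_spaceD(3)[OF \<eta>] normal_height_zero[OF u n(2)] by (simp add: dt6_form n(1))
  finally have "\<eta> = 0" using pos_def_onD[OF X.normal_space(2)[OF u] \<eta>] by simp
  then show ?thesis by (simp add: \<eta>_def)
qed

lemma T_nonzero:
  assumes u: "u \<in> U"
  shows "T u \<noteq> 0"
  using deriv_X_T[OF u] linear_0[OF X.linear_deriv[OF u]] by (auto simp: dt6_def zero_prod_def)

lemma shape_op_T:
  assumes u: "u \<in> U" and \<xi>: "\<xi> \<in> normal_space (E6_form \<epsilon>) (Q4_R \<epsilon>) X u"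
  shows "shape_op (E6_form \<epsilon>) (Q4_R \<epsilon>) X u \<xi> (T u) = 0"
  using X.shape_op_tangent_part[OF u \<xi> T_differentiable[OF u] twice_diff_onD(1)[OF \<theta>(1)] u deriv_X_T] .

end


section \<open>Charts\<close>

lemma twice_diff_on_subset: "twice_diff_on U F \<Longrightarrow> open V \<Longrightarrow> V \<subseteq> U \<Longrightarrow> twice_diff_on V F"
  unfolding twice_diff_on_def by blast

lemma param_immersion_chart:
  assumes "riemannian_target g N" "immersion N M A f" "\<Union>((\<lambda>(U, x). x ` U) ` A) \<subseteq> M" "(U, x) \<in> A"
    and "open U" "open W" "W \<subseteq> U"
  shows "param_immersion g N W (f \<circ> x)"
proof -
  interpret riemannian_target g N by fact
  have im: "f ` M \<subseteq> N" "smooth_on U (f \<circ> x)" "\<And>u. u \<in> U \<Longrightarrow> inj (deriv_at (f \<circ> x) u)"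
    using assms(2,4) unfolding immersion_def by auto
  show ?thesis
  proof
    show "twice_diff_on W (f \<circ> x)"
      by (rule twice_diff_on_subset[OF smooth_on_imp_twice_diff_on[OF assms(5) im(2)] assms(6,7)])
    fix u assume "u \<in> W"
    then show "(f \<circ> x) u \<in> N" "inj (deriv_at (f \<circ> x) u)"
      using assms(3,4,7) im by (force, blast)
  qed
qed

lemma smooth_manifoldD:
  assumes "smooth_manifold M A" "(U, x) \<in> A"
  shows "open U" "openin (top_of_set M) (x ` U)" "continuous_on U x" "x ` U \<subseteq> M"
    "\<Union>((\<lambda>(U, x). x ` U) ` A) = M"
proof -
  have *: "\<And>U x. (U, x) \<in> A \<Longrightarrow> open U \<and> openin (top_of_set M) (x ` U) \<and> (\<exists>y. homeomorphism U (x ` U) x y)"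
    and M: "\<Union>((\<lambda>(U, x). x ` U) ` A) = M"
    using assms(1) unfolding smooth_manifold_def by auto
  show "open U" "openin (top_of_set M) (x ` U)" "continuous_on U x"
    using *[OF assms(2)] homeomorphism_cont1 by auto
  show "\<Union>((\<lambda>(U, x). x ` U) ` A) = M" by (rule M)
  show "x ` U \<subseteq> M" using assms(2) unfolding M[symmetric] by force
qed

text \<open>\<open>\<theta>\<close> is the inverse of \<open>\<psi>\<close> read from the chart
  \<open>x\<close> of \<open>M\<close> to the product of a surface chart \<open>y\<close> with the
  interval, on the part of \<open>U\<close> where this makes sense.\<close>

lemma product_chart:
  assumes M: "smooth_manifold M A" and c: "(U, x) \<in> A" and u: "u \<in> U" "x u \<in> W"
    and S: "smooth_manifold S B" and W: "openin (top_of_set M) W"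
    and \<psi>: "diffeo (S \<times> I) (prod_interval_atlas B I) W (restrict_atlas A W) \<psi>"
  obtains V y \<Omega> \<theta> where "(V, y) \<in> B" "open \<Omega>" "u \<in> \<Omega>" "\<Omega> \<subseteq> U" "smooth_on \<Omega> \<theta>"
    "\<forall>u\<in>\<Omega>. fst (\<theta> u) \<in> V \<and> snd (\<theta> u) \<in> I \<and> \<psi> (y (fst (\<theta> u)), snd (\<theta> u)) = x u"
proof -
  let ?F = "inv_into (S \<times> I) \<psi>"
  have bij: "bij_betw \<psi> (S \<times> I) W"
    and sm: "smooth_map W (restrict_atlas A W) (S \<times> I) (prod_interval_atlas B I) ?F"
    using \<psi> unfolding diffeo_def by auto
  have F: "?F ` W \<subseteq> S \<times> I" "continuous_on W ?F" using sm unfolding smooth_map_def by auto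
  have "?F (x u) \<in> S \<times> I" using F(1) u(2) by blast
  then obtain p s where ps: "?F (x u) = (p, s)" "p \<in> S" "s \<in> I" by (cases "?F (x u)") auto
  have "p \<in> \<Union>((\<lambda>(U, x). x ` U) ` B)" using ps(2) S unfolding smooth_manifold_def by simp
  then obtain V y where Vy: "(V, y) \<in> B" "p \<in> y ` V" by auto
  let ?U = "U \<inter> x -` W" and ?m = "map_prod y id :: _ \<Rightarrow> _ \<times> real"
  let ?\<Omega> = "?U \<inter> (?F \<circ> x) -` (?m ` (V \<times> I))" and ?\<theta> = "inv_into (V \<times> I) ?m \<circ> (?F \<circ> x)"
  note x = smooth_manifoldD[OF M c] and y = smooth_manifoldD[OF S Vy(1)]
  have mem: "(?U, x) \<in> restrict_atlas A W" "(V \<times> I, ?m) \<in> prod_interval_atlas B I"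
    unfolding restrict_atlas_def prod_interval_atlas_def
    by (rule image_eqI[OF _ c], simp, rule image_eqI[OF _ Vy(1)], simp)
  from sm[unfolded smooth_map_def] have "\<forall>c\<in>restrict_atlas A W. \<forall>d\<in>prod_interval_atlas B I.
      case transition c d ?F of (W, \<theta>) \<Rightarrow> smooth_on W \<theta>"
    by (elim conjE)
  from bspec[OF bspec[OF this mem(1)] mem(2)] have \<theta>: "smooth_on ?\<Omega> ?\<theta>"
    unfolding transition_def prod.case .
  have m: "?m ` (V \<times> I) = y ` V \<times> I" by (simp add: map_prod_surj_on[of y V _ id I])
  \<comment> \<open>Sets open relative to \<open>M\<close> or \<open>S \<times> I\<close> become
    open in the parameter space once pulled back to the open chart domain.\<close>
  have "openin (top_of_set U) ?U"
    by (rule continuous_openin_preimage[OF x(3) _ W]) (use x(4) in auto)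
  then have oU: "open ?U" using x(1) openin_open_trans by blast
  have "continuous_on ?U (?F \<circ> x)"
    by (intro continuous_on_compose continuous_on_subset[OF x(3)] continuous_on_subset[OF F(2)]) auto
  moreover have "(?F \<circ> x) \<in> ?U \<rightarrow> S \<times> I" using F(1) by auto
  moreover have "openin (top_of_set (S \<times> I)) (?m ` (V \<times> I))"
    unfolding m by (intro openin_Times y(2)) simp
  ultimately have "openin (top_of_set ?U) ?\<Omega>" by (rule continuous_openin_preimage)
  then have o\<Omega>: "open ?\<Omega>" using oU openin_open_trans by blast
  have "u \<in> ?\<Omega>" using u ps Vy(2) unfolding m by simp
  moreover have "fst (?\<theta> u) \<in> V \<and> snd (?\<theta> u) \<in> I \<and> \<psi> (y (fst (?\<theta> u)), snd (?\<theta> u)) = x u"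
    if "u \<in> ?\<Omega>" for u
  proof -
    have Fx: "?F (x u) \<in> ?m ` (V \<times> I)" "x u \<in> W" using that by simp_all
    have "?\<theta> u \<in> V \<times> I" using inv_into_into[OF Fx(1)] by simp
    moreover have "?m (?\<theta> u) = ?F (x u)" using f_inv_into_f[OF Fx(1)] by simp
    moreover have "\<psi> (?F (x u)) = x u"
      using f_inv_into_f[of "x u" \<psi> "S \<times> I"] bij Fx(2) by (simp add: bij_betw_def)
    ultimately show ?thesis by (simp add: map_prod_def split_beta mem_Times_iff)
  qed
  ultimately show ?thesis by (intro that[OF Vy(1) o\<Omega> _ _ \<theta>] ballI) auto
qed

theorem corollary5p2:
  fixes \<epsilon> :: real
    and M :: "'p::{t2_space, second_countable_topology} set"
    and A :: "(real^3, 'p) atlas"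
    and f :: "'p \<Rightarrow> (real^2) \<times> (real^3) \<times> real"
  assumes "\<epsilon> \<in> {1, -1}"
    and "smooth_manifold M A"
    and "immersion (Q4_R \<epsilon>) M A f"
    and "biconservative (E6_form \<epsilon>) (Q4_R \<epsilon>) A f"
    and "nonzero_parallel_mean_curv (E6_form \<epsilon>) (Q4_R \<epsilon>) A f"
    and "\<forall>q\<in>M. \<exists>(a::real) (b::real) (S :: 'q::{t2_space, second_countable_topology} set)
            (B :: (real^2, 'q) atlas) (\<phi> :: 'q \<Rightarrow> (real^3) \<times> real) (I :: real set) W \<psi>.
          a \<noteq> 0 \<and> b > 0 \<and> \<bar>a\<bar> < 1 \<and> a\<^sup>2 + b\<^sup>2 = 1 \<and>
          oriented_manifold S B \<and>
          immersion (Q2_R \<epsilon> b) S B \<phi> \<and>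
          minimal (E4_form \<epsilon>) (Q2_R \<epsilon> b) B \<phi> \<and>
          nowhere_zero_tangent_part (E4_form \<epsilon>) (Q2_R \<epsilon> b) dt4 B \<phi> \<and>
          open I \<and> is_interval I \<and>
          openin (top_of_set M) W \<and> q \<in> W \<and>
          diffeo (S \<times> I) (prod_interval_atlas B I) W (restrict_atlas A W) \<psi> \<and>
          (\<forall>p\<in>S. \<forall>s\<in>I. f (\<psi> (p, s)) = (circle_pt b s, \<phi> p))"
  shows "class_A (E6_form \<epsilon>) (Q4_R \<epsilon>) dt6 M A f"
proof -
  have main: "tangent_part (E6_form \<epsilon>) (Q4_R \<epsilon>) dt6 (f \<circ> x) u \<noteq> 0 \<and>
      shape_op (E6_form \<epsilon>) (Q4_R \<epsilon>) (f \<circ> x) u \<xi> (tangent_part (E6_form \<epsilon>) (Q4_R \<epsilon>) dt6 (f \<circ> x) u) = 0"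
    if c: "(U, x) \<in> A" and u: "u \<in> U" and \<xi>: "\<xi> \<in> normal_space (E6_form \<epsilon>) (Q4_R \<epsilon>) (f \<circ> x) u"
    for U x u \<xi>
  proof -
    note x = smooth_manifoldD[OF assms(2) c]
    have "x u \<in> M" using x(4) u by blast
    \<comment> \<open>The radius, the surface and the splitting may vary with the point, so they are
      chosen afresh for each \<open>u\<close>.\<close>
    note loc = bspec[OF assms(6) this]
    obtain a b :: real and S :: "'q set" and B :: "(real^2, 'q) atlas"
      and \<phi> I W \<psi> where ab: "a \<noteq> 0" "b > 0" "a\<^sup>2 + b\<^sup>2 = 1"
      and S: "oriented_manifold S B" and \<phi>: "immersion (Q2_R \<epsilon> b) S B \<phi>"
        "minimal (E4_form \<epsilon>) (Q2_R \<epsilon> b) B \<phi>"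
        "nowhere_zero_tangent_part (E4_form \<epsilon>) (Q2_R \<epsilon> b) dt4 B \<phi>"
      and W: "openin (top_of_set M) W" "x u \<in> W"
      and \<psi>: "diffeo (S \<times> I) (prod_interval_atlas B I) W (restrict_atlas A W) \<psi>"
      and f: "\<forall>p\<in>S. \<forall>s\<in>I. f (\<psi> (p, s)) = (circle_pt b s, \<phi> p)"
      using loc by (elim exE conjE) (rule that; assumption)
    have S': "smooth_manifold S B" using S by (simp add: oriented_manifold_def)
    obtain V y \<Omega> \<theta> where y: "(V, y) \<in> B" and \<Omega>: "open \<Omega>" "u \<in> \<Omega>" "\<Omega> \<subseteq> U" and \<theta>: "smooth_on \<Omega> \<theta>"
      "\<forall>u\<in>\<Omega>. fst (\<theta> u) \<in> V \<and> snd (\<theta> u) \<in> I \<and> \<psi> (y (fst (\<theta> u)), snd (\<theta> u)) = x u"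
      using product_chart[OF assms(2) c u W(2) S' W(1) \<psi>] .
    note V = smooth_manifoldD[OF S' y]
    \<comment> \<open>Since \<open>a \<noteq> 0\<close>, \<open>b\<^sup>2\<close> lies strictly
      between 0 and 1 and so differs from both values of \<open>\<epsilon>\<close>; this is what
      makes \<open>c\<close> nonzero.\<close>
    have "b\<^sup>2 < 1" using ab by (smt (verit) zero_less_power2)
    then have b: "b\<^sup>2 \<noteq> \<epsilon>" using assms(1) zero_le_power2[of b] by (smt (verit) insertE singletonD)
    interpret circle_cylinder \<epsilon> b \<Omega> "f \<circ> x" V "\<phi> \<circ> y" \<theta>
    proof (rule circle_cylinder.intro)
      show "\<epsilon> \<in> {1, -1}" "b > 0" "b\<^sup>2 \<noteq> \<epsilon>" by fact+
      show "param_immersion (E6_form \<epsilon>) (Q4_R \<epsilon>) \<Omega> (f \<circ> x)"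
        using param_immersion_chart[OF riemannian_Q4_R[OF assms(1)] assms(3) _ c x(1) \<Omega>(1,3)] x(5) by blast
      show "param_immersion (E4_form \<epsilon>) (Q2_R \<epsilon> b) V (\<phi> \<circ> y)"
        using param_immersion_chart[OF riemannian_Q2_R[OF assms(1) b[symmetric]] \<phi>(1) _ y V(1) V(1)] V(5) by blast
      show "twice_diff_on \<Omega> \<theta>" by (rule smooth_on_imp_twice_diff_on[OF \<Omega>(1) \<theta>(1)])
      fix u assume u: "u \<in> \<Omega>"
      show "fst (\<theta> u) \<in> V" using bspec[OF \<theta>(2) u] by simp
      have "y (fst (\<theta> u)) \<in> S" using bspec[OF \<theta>(2) u] V(4) by blast
      then show "(f \<circ> x) u = (circle_pt b (snd (\<theta> u)), (\<phi> \<circ> y) (fst (\<theta> u)))"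
        using bspec[OF \<theta>(2) u] f by (metis comp_apply)
      have "u \<in> U" using u \<Omega>(3) by blast
      then show "mean_curv (E6_form \<epsilon>) (Q4_R \<epsilon>) (f \<circ> x) u \<noteq> 0"
        "normal_conn (E6_form \<epsilon>) (Q4_R \<epsilon>) (f \<circ> x) (mean_curv (E6_form \<epsilon>) (Q4_R \<epsilon>) (f \<circ> x)) u v = 0" for v
        using assms(5) c unfolding nonzero_parallel_mean_curv_def by auto
    next
      fix v assume "v \<in> V"
      then show "mean_curv (E4_form \<epsilon>) (Q2_R \<epsilon> b) (\<phi> \<circ> y) v = 0"
        "tangent_part (E4_form \<epsilon>) (Q2_R \<epsilon> b) dt4 (\<phi> \<circ> y) v \<noteq> 0"
        using \<phi>(2,3) y unfolding minimal_def nowhere_zero_tangent_part_def by auto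
    qed
    show ?thesis using T_nonzero[OF \<Omega>(2)] shape_op_T[OF \<Omega>(2) \<xi>] by simp
  qed
  show ?thesis
    unfolding class_A_def Let_def using assms(3) main by (auto intro!: exI[of _ 0])
qed

end
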